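(* Let $\gamma\in(0,2)$, $\theta>1$ and $T>\gamma^{-1}$. For $t\in(0,\gamma^{-1})$ let $u(t)$ be the measure $$u(t,x)=(1-\gamma t)^{\frac1\gamma}\,\delta\!\left(x-(1-\gamma t)^{-\frac1\gamma}\right)+u^R(t,x)\,H\!\left(1-(1-\gamma t)^{\frac1\gamma}x\right),$$ $$u^R(t,x)=\theta(1-\gamma t)^{\frac2\gamma}\,t\,F\!\left(1+\frac{\sigma_1}\gamma,1+\frac{\sigma_2}\gamma,2,\gamma t\,(1+(\gamma t-1)x^\gamma)\right)$$ (a non negative weak solution of (E) on $(0,\gamma^{-1})$). Then there is no extension of $u$ to a non negative weak solution $w\in\mathscr D_1'((0,T)\times(0,\infty))$ of (E) on $(0,T)$ (that is, with $w=u$ on $(0,\gamma^{-1})$) such that, for some $\rho\in(0,2-\gamma)$, $$w\in C\left([0,T);\mathscr M_{\rho-1-\delta}\cap\mathscr M_{\rho+\gamma-1+\delta}\right)\quad\text{for some }\delta>0,$$ and satisfying the initial condition $w(t)\rightharpoonup\delta_1$ in $E'_{\rho,\rho+\gamma}$ as $t\to0$.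
   Context: Equation (E): $$\partial_tu(t,x)+\partial_x\big(x^{1+\gamma}u(t,x)\big)+x^\gamma u(t,x)=\theta\int_x^\infty y^{\gamma-1}u(t,y)\,dy,\quad t>0,\ x>0.$$ Measures are written as if they had densities. A measure $u$ is a weak solution of (E) on $(t_0,t_1)$ if for all $\varphi\in C_c^1((t_0,t_1)\times(0,\infty))$: $$\int_0^\infty\!\!\int_0^\infty\left(\partial_t\varphi+x^{\gamma+1}\partial_x\varphi-x^\gamma\varphi\right)u(t,x)\,dx\,dt=-\theta\int_0^\infty\!\!\int_0^\infty u(t,y)y^{\gamma-1}\int_0^y\varphi(t,x)\,dx\,dy\,dt.$$ $\mathscr D_1'$ is the set of distributions of order one. $\sigma_1=1-\sqrt{1-\theta}$, $\sigma_2=1+\sqrt{1-\theta}$ (with $\sqrt{1-\theta}=i\sqrt{\theta-1}$ if $\theta>1$). $F={}_2F_1$ is the Gauss hypergeometric function, $H$ the Heaviside function, $\delta_1$ the Dirac mass at $x=1$, $\delta(x-a)$ the Dirac mass at $a$. For $p<q$, $E_{p,q}$ is the space of $\phi\in C^\infty(0,\infty)$ such that for every integer $k\ge0$, $\sup_{x>0}k_{p,q}(x)x^{k+1}|\phi^{(k)}(x)|<\infty$, where $k_{p,q}(x)=x^{-p}$ for $0<x\le1$ and $k_{p,q}(x)=x^{-q}$ for $x>1$, topologized by these seminorms; $E'_{p,q}$ is its dual, and $\rightharpoonup$ is weak-* convergence. $\mathscr M_\rho$ is the space of measures $u$ on $(0,\infty)$ with $\int_0^\infty x^\rho u(x)\,dx<\infty$;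 continuity in time with values in $\mathscr M_\rho$ means continuity of $t\mapsto\int_0^\infty x^\rho\psi(x)u(t,x)\,dx$ for every bounded continuous $\psi$. *)

theory Defs
  imports "HOL-Analysis.Analysis" "HOL-Probability.Giry_Monad" "HOL-Real_Asymp.Real_Asymp"
begin

section \<open>Measures on the half-line\<close>

abbreviation halfline :: "real measure" where
  "halfline \<equiv> restrict_space lborel {0<..}"

text \<open>Elements of Isabelle's type of measures are non-negative, so every measure below, and every
  weak solution, is non-negative by typing.\<close>

definition add_measure :: "'a measure \<Rightarrow> 'a measure \<Rightarrow> 'a measure" where
  "add_measure M N = measure_of (space M) (sets M) (\<lambda>A. emeasure M A + emeasure N A)"

lemma space_add_measure [simp]: "space (add_measure M N) = space M"
  by (simp add: add_measure_def sets.space_closed space_measure_of)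

lemma sets_add_measure [simp]: "sets (add_measure M N) = sets M"
  by (simp add: add_measure_def sets.space_closed)

lemma emeasure_add_measure:
  assumes "sets N = sets M" and "A \<in> sets M"
  shows "emeasure (add_measure M N) A = emeasure M A + emeasure N A"
proof (rule emeasure_measure_of[OF add_measure_def sets.space_closed])
  show "A \<in> sets (add_measure M N)"
    using assms(2) by simp
  show "positive (sets (add_measure M N)) (\<lambda>A. emeasure M A + emeasure N A)"
    by (simp add: positive_def)
  show "countably_additive (sets (add_measure M N)) (\<lambda>A. emeasure M A + emeasure N A)"
  proof (rule countably_additiveI)
    fix B :: "nat \<Rightarrow> 'a set"
    assume B: "range B \<subseteq> sets (add_measure M N)" "disjoint_family B"
    have "(\<Sum>i. emeasure M (B i) + emeasure N (B i)) = (\<Sum>i. emeasure M (B i)) + (\<Sum>i. emeasure N (B i))"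
      by (rule suminf_add[symmetric]) auto
    also have "\<dots> = emeasure M (\<Union> (range B)) + emeasure N (\<Union> (range B))"
      using B assms(1) by (simp add: suminf_emeasure)
    finally show "(\<Sum>i. emeasure M (B i) + emeasure N (B i)) =
        emeasure M (\<Union> (range B)) + emeasure N (\<Union> (range B))" .
  qed
qed

text \<open>The space \<open>\<M>\<^sub>\<rho>\<close>, restricted to non-negative measures.\<close>

definition moment_space :: "real \<Rightarrow> real measure set" where
  "moment_space \<rho> = {m. sets m = sets halfline \<and> (\<integral>\<^sup>+x. ennreal (x powr \<rho>) \<partial>m) < \<infinity>}"

definition continuous_in_moment_space :: "real \<Rightarrow> real set \<Rightarrow> (real \<Rightarrow> real measure) \<Rightarrow> bool" where
  "continuous_in_moment_space \<rho> I u \<longleftrightarrow>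
     (\<forall>t\<in>I. u t \<in> moment_space \<rho>) \<and>
     (\<forall>\<psi>::real \<Rightarrow> real. continuous_on {0<..} \<psi> \<and> bounded (\<psi> ` {0<..}) \<longrightarrow>
        continuous_on I (\<lambda>t. LINT x|u t. x powr \<rho> * \<psi> x))"


section \<open>Test functions and distributions of order one on \<open>(a,b) \<times> (0,\<infinity>)\<close>\<close>

abbreviation strip :: "real \<Rightarrow> real \<Rightarrow> (real \<times> real) set" where
  "strip a b \<equiv> {a<..<b} \<times> {0<..}"

definition dt :: "(real \<times> real \<Rightarrow> real) \<Rightarrow> real \<times> real \<Rightarrow> real" where
  "dt \<phi> = (\<lambda>(t, x). deriv (\<lambda>s. \<phi> (s, x)) t)"

definition dx :: "(real \<times> real \<Rightarrow> real) \<Rightarrow> real \<times> real \<Rightarrow> real" where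
  "dx \<phi> = (\<lambda>(t, x). deriv (\<lambda>y. \<phi> (t, y)) x)"

text \<open>\<open>C\<^sub>c\<^sup>1(\<Omega>)\<close> for an open set \<open>\<Omega>\<close>: functions in \<open>C\<^sup>1\<close> on the whole plane that vanish outside a compact
  subset of \<open>\<Omega>\<close>. Real-valued test functions suffice, since all measures are real.\<close>

definition C1c :: "(real \<times> real) set \<Rightarrow> (real \<times> real \<Rightarrow> real) set" where
  "C1c \<Omega> = {\<phi>. (\<forall>z. \<phi> differentiable (at z)) \<and> continuous_on UNIV (dt \<phi>) \<and> continuous_on UNIV (dx \<phi>) \<and>
     (\<exists>K. compact K \<and> K \<subseteq> \<Omega> \<and> (\<forall>z. z \<notin> K \<longrightarrow> \<phi> z = 0))}"

text \<open>Distributions of order (at most) one, extended by density to \<open>C\<^sub>c\<^sup>1(\<Omega>)\<close>: linear functionals on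
  \<open>C\<^sub>c\<^sup>1(\<Omega>)\<close> which, on functions supported in a fixed compact set, are bounded by the \<open>C\<^sup>1\<close> norm.\<close>

definition distributions1 :: "(real \<times> real) set \<Rightarrow> ((real \<times> real \<Rightarrow> real) \<Rightarrow> real) set" where
  "distributions1 \<Omega> = {L.
     (\<forall>\<phi>\<in>C1c \<Omega>. \<forall>\<psi>\<in>C1c \<Omega>. L (\<lambda>z. \<phi> z + \<psi> z) = L \<phi> + L \<psi>) \<and>
     (\<forall>c. \<forall>\<phi>\<in>C1c \<Omega>. L (\<lambda>z. c * \<phi> z) = c * L \<phi>) \<and>
     (\<forall>K. compact K \<and> K \<subseteq> \<Omega> \<longrightarrow>
        (\<exists>C. \<forall>\<phi>\<in>C1c \<Omega>. (\<forall>z. z \<notin> K \<longrightarrow> \<phi> z = 0) \<longrightarrow>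
           \<bar>L \<phi>\<bar> \<le> C * (SUP z. \<bar>\<phi> z\<bar> + \<bar>dt \<phi> z\<bar> + \<bar>dx \<phi> z\<bar>)))}"

text \<open>A measure \<open>u(t,x) dx dt\<close> on \<open>(a,b) \<times> (0,\<infinity>)\<close> is given by its time slices \<open>u t\<close>: a measurable family
  of measures on the half-line whose integral in time is locally finite.\<close>

definition measure_curve :: "real \<Rightarrow> real \<Rightarrow> (real \<Rightarrow> real measure) \<Rightarrow> bool" where
  "measure_curve a b u \<longleftrightarrow>
     (\<forall>t\<in>{a<..<b}. sets (u t) = sets halfline) \<and>
     (\<forall>A\<in>sets halfline. (\<lambda>t. emeasure (u t) A) \<in> borel_measurable (restrict_space borel {a<..<b})) \<and>
     (\<forall>K. compact K \<and> K \<subseteq> strip a b \<longrightarrow>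
        (\<integral>\<^sup>+t\<in>{a<..<b}. emeasure (u t) {x. (t, x) \<in> K} \<partial>lborel) < \<infinity>)"

definition curve_functional ::
    "real \<Rightarrow> real \<Rightarrow> (real \<Rightarrow> real measure) \<Rightarrow> (real \<times> real \<Rightarrow> real) \<Rightarrow> real" where
  "curve_functional a b u \<phi> = (LBINT t:{a<..<b}. (LINT x|u t. \<phi> (t, x)))"


section \<open>Weak solutions of the equation\<close>

text \<open>The inner integrand on the right-hand side is not compactly supported in \<open>y\<close>; that the
  iterated integral on the right exists is therefore part of the notion of weak solution.
  Requiring it for all \<open>\<phi>\<close>, of either sign, amounts to absolute convergence. The left-hand side
  always converges, by local finiteness of the measure.\<close>

definition weak_solution :: "real \<Rightarrow> real \<Rightarrow> real \<Rightarrow> real \<Rightarrow> (real \<Rightarrow> real measure) \<Rightarrow> bool" where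
  "weak_solution \<gamma> \<theta> a b u \<longleftrightarrow> measure_curve a b u \<and>
     (\<forall>\<phi>\<in>C1c (strip a b).
        (AE t in lborel. t \<in> {a<..<b} \<longrightarrow>
           integrable (u t) (\<lambda>y. y powr (\<gamma> - 1) * (LBINT x:{0<..<y}. \<phi> (t, x)))) \<and>
        set_integrable lborel {a<..<b}
          (\<lambda>t. LINT y|u t. y powr (\<gamma> - 1) * (LBINT x:{0<..<y}. \<phi> (t, x))) \<and>
        (LBINT t:{a<..<b}. (LINT x|u t.
           dt \<phi> (t, x) + x powr (\<gamma> + 1) * dx \<phi> (t, x) - x powr \<gamma> * \<phi> (t, x)))
        = - \<theta> * (LBINT t:{a<..<b}. (LINT y|u t.
           y powr (\<gamma> - 1) * (LBINT x:{0<..<y}. \<phi> (t, x)))))"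


section \<open>The explicit solution before time \<open>1/\<gamma>\<close>\<close>

text \<open>The Gauss hypergeometric function on the unit disc, where the defining series converges.
  Below, its values matter only at points of \<open>(0,1)\<close>; elsewhere they are multiplied by zero.\<close>

definition hyp2F1 :: "complex \<Rightarrow> complex \<Rightarrow> complex \<Rightarrow> complex \<Rightarrow> complex" where
  "hyp2F1 a b c z = eval_fps (fps_hypergeo [a, b] [c] 1) z"

lemma hyp2F1_eq_suminf:
  "hyp2F1 a b c z = (\<Sum>n. pochhammer a n * pochhammer b n / (pochhammer c n * fact n) * z ^ n)"
  by (simp add: hyp2F1_def eval_fps_def)

lemma hyp2F1_cnj:
  fixes a :: complex and r :: real
  assumes a: "Re a > 0" and r: "0 \<le> r" "r < 1"
  shows "hyp2F1 a (cnj a) 2 (of_real r) \<in> \<real>" "Re (hyp2F1 a (cnj a) 2 (of_real r)) \<ge> 0"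
proof -
  define p :: "nat \<Rightarrow> real" where "p n = (cmod (pochhammer a n))\<^sup>2 / (pochhammer 2 n * fact n)" for n
  have pc: "pochhammer (cnj a) n = cnj (pochhammer a n)" for n
    by (induction n) (simp_all add: pochhammer_Suc)
  have c2: "pochhammer (2::complex) n = of_real (pochhammer 2 n)" for n
    by (induction n) (simp_all add: pochhammer_Suc)
  have trm: "pochhammer a n * pochhammer (cnj a) n / (pochhammer 2 n * fact n) * of_real r ^ n
      = complex_of_real (p n * r ^ n)" for n
    unfolding p_def pc c2 complex_norm_square[symmetric]
    by (simp only: of_real_mult of_real_divide of_real_fact of_real_power)
  have p0: "p n > 0" for n
    using a by (auto simp: p_def pochhammer_eq_0_iff intro!: divide_pos_pos mult_pos_pos pochhammer_pos)
  have "p n / p (Suc n) = (2 + real n) * (real n + 1) / ((Re a + n)\<^sup>2 + (Im a)\<^sup>2)" for n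
  proof -
    have "cmod (pochhammer a n) \<noteq> 0" using a by (auto simp: pochhammer_eq_0_iff)
    moreover have "pochhammer (2::real) n \<noteq> 0" using pochhammer_pos[of "2::real" n] by simp
    moreover have "(cmod (a + of_nat n))\<^sup>2 = (Re a + n)\<^sup>2 + (Im a)\<^sup>2" by (simp add: cmod_power2)
    moreover have "(Re a + n)\<^sup>2 + (Im a)\<^sup>2 \<noteq> 0" using a by (simp add: sum_power2_eq_zero_iff)
    ultimately show ?thesis
      by (simp add: p_def pochhammer_Suc norm_mult power_mult_distrib divide_simps)
  qed
  moreover have "(\<lambda>n. (2 + real n) * (real n + 1) / ((Re a + n)\<^sup>2 + (Im a)\<^sup>2)) \<longlonglongrightarrow> 1"
    by real_asymp
  ultimately have "conv_radius p = ereal 1"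
    using p0 by (intro conv_radius_ratio_limit_nonzero) (simp_all add: abs_of_pos less_imp_neq[THEN not_sym])
  then have "summable (\<lambda>n. p n * r ^ n)"
    using r by (intro summable_in_conv_radius) simp
  then have eq: "hyp2F1 a (cnj a) 2 (of_real r) = of_real (\<Sum>n. p n * r ^ n)"
    and ge: "(\<Sum>n. p n * r ^ n) \<ge> 0"
    unfolding hyp2F1_eq_suminf trm
    using less_imp_le[OF p0] r by (simp_all add: suminf_of_real suminf_nonneg)
  show "hyp2F1 a (cnj a) 2 (of_real r) \<in> \<real>" "Re (hyp2F1 a (cnj a) 2 (of_real r)) \<ge> 0"
    unfolding eq using ge by simp_all
qed

definition \<sigma>1 :: "real \<Rightarrow> complex" where
  "\<sigma>1 \<theta> = 1 - csqrt (complex_of_real (1 - \<theta>))"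

definition \<sigma>2 :: "real \<Rightarrow> complex" where
  "\<sigma>2 \<theta> = 1 + csqrt (complex_of_real (1 - \<theta>))"

lemma csqrt_one_minus: "\<theta> > 1 \<Longrightarrow> csqrt (complex_of_real (1 - \<theta>)) = \<i> * sqrt (\<theta> - 1)"
  by (subst csqrt_of_real_nonpos) simp_all

text \<open>For \<open>\<theta> > 1\<close> the first two parameters are complex conjugates and the argument lies in \<open>(0,1)\<close>
  on the support of the Heaviside factor, so there the value of \<open>F\<close> is a non-negative real number
  (see \<open>uR_well_defined\<close>); taking the real part only changes the type.\<close>

definition uR :: "real \<Rightarrow> real \<Rightarrow> real \<Rightarrow> real \<Rightarrow> real" where
  "uR \<gamma> \<theta> t x = \<theta> * (1 - \<gamma> * t) powr (2 / \<gamma>) * t *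
     Re (hyp2F1 (1 + \<sigma>1 \<theta> / of_real \<gamma>) (1 + \<sigma>2 \<theta> / of_real \<gamma>) 2
           (of_real (\<gamma> * t * (1 + (\<gamma> * t - 1) * x powr \<gamma>))))"

lemma uR_measurable [measurable]: "uR \<gamma> \<theta> t \<in> borel_measurable borel"
  unfolding uR_def hyp2F1_eq_suminf
  by measurable
lemma uR_well_defined:
  assumes "\<gamma> > 0" "\<theta> > 1" "0 < t" "\<gamma> * t < 1" "x > 0" "(1 - \<gamma> * t) powr (1 / \<gamma>) * x < 1"
  shows "hyp2F1 (1 + \<sigma>1 \<theta> / of_real \<gamma>) (1 + \<sigma>2 \<theta> / of_real \<gamma>) 2
           (of_real (\<gamma> * t * (1 + (\<gamma> * t - 1) * x powr \<gamma>))) \<in> \<real>"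
    and "uR \<gamma> \<theta> t x \<ge> 0"
proof -
  define a where "a = 1 + \<sigma>1 \<theta> / complex_of_real \<gamma>"
  define r where "r = \<gamma> * t * (1 + (\<gamma> * t - 1) * x powr \<gamma>)"
  have b: "1 + \<sigma>2 \<theta> / complex_of_real \<gamma> = cnj a"
    using assms by (simp add: a_def \<sigma>1_def \<sigma>2_def csqrt_one_minus del: of_real_diff)
  have re: "Re a > 0"
    using assms by (simp add: a_def \<sigma>1_def csqrt_one_minus add_pos_pos del: of_real_diff)
  have "((1 - \<gamma> * t) powr (1 / \<gamma>) * x) powr \<gamma> < 1 powr \<gamma>"
    using assms by (intro powr_less_mono2) auto
  then have "(1 - \<gamma> * t) * x powr \<gamma> < 1"
    using assms by (simp add: powr_mult powr_powr)
  moreover have "(1 - \<gamma> * t) * x powr \<gamma> \<ge> 0"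
    using assms by simp
  ultimately have s: "0 \<le> 1 + (\<gamma> * t - 1) * x powr \<gamma>" "1 + (\<gamma> * t - 1) * x powr \<gamma> \<le> 1"
    by (simp_all add: algebra_simps)
  have r0: "0 \<le> r" using s assms by (simp add: r_def)
  have "r \<le> \<gamma> * t * 1" unfolding r_def using s assms by (intro mult_left_mono) auto
  then have r1: "r < 1" using assms by simp
  show "hyp2F1 (1 + \<sigma>1 \<theta> / of_real \<gamma>) (1 + \<sigma>2 \<theta> / of_real \<gamma>) 2
           (of_real (\<gamma> * t * (1 + (\<gamma> * t - 1) * x powr \<gamma>))) \<in> \<real>"
    using hyp2F1_cnj(1)[OF re r0 r1] unfolding b a_def[symmetric] r_def .
  show "uR \<gamma> \<theta> t x \<ge> 0"
    using hyp2F1_cnj(2)[OF re r0 r1] assms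
    unfolding uR_def b a_def[symmetric] r_def by simp
qed

definition heaviside :: "real \<Rightarrow> real" where
  "heaviside = indicator {0<..}"

definition explicit_solution :: "real \<Rightarrow> real \<Rightarrow> real \<Rightarrow> real measure" where
  "explicit_solution \<gamma> \<theta> t =
     add_measure
       (scale_measure (ennreal ((1 - \<gamma> * t) powr (1 / \<gamma>)))
          (return halfline ((1 - \<gamma> * t) powr (- 1 / \<gamma>))))
       (density halfline
          (\<lambda>x. ennreal (uR \<gamma> \<theta> t x * heaviside (1 - (1 - \<gamma> * t) powr (1 / \<gamma>) * x))))"


section \<open>The spaces \<open>E\<^sub>p\<^sub>,\<^sub>q\<close> and their duals\<close>

definition weight :: "real \<Rightarrow> real \<Rightarrow> real \<Rightarrow> real" where
  "weight p q x = (if x \<le> 1 then x powr (- p) else x powr (- q))"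

text \<open>Functions on \<open>(0,\<infinity>)\<close> are total functions whose values outside \<open>(0,\<infinity>)\<close> are irrelevant.\<close>

definition E_space :: "real \<Rightarrow> real \<Rightarrow> (real \<Rightarrow> real) set" where
  "E_space p q = {\<phi>. \<forall>k. (\<forall>x>0. (deriv ^^ k) \<phi> differentiable (at x)) \<and>
     bdd_above ((\<lambda>x. weight p q x * x ^ (k + 1) * \<bar>(deriv ^^ k) \<phi> x\<bar>) ` {0<..})}"

definition E_seminorm :: "real \<Rightarrow> real \<Rightarrow> nat \<Rightarrow> (real \<Rightarrow> real) \<Rightarrow> real" where
  "E_seminorm p q k \<phi> = (SUP x\<in>{0<..}. weight p q x * x ^ (k + 1) * \<bar>(deriv ^^ k) \<phi> x\<bar>)"

definition E_dual :: "real \<Rightarrow> real \<Rightarrow> ((real \<Rightarrow> real) \<Rightarrow> real) set" where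
  "E_dual p q = {L.
     (\<forall>\<phi>\<in>E_space p q. \<forall>\<psi>\<in>E_space p q. L (\<lambda>x. \<phi> x + \<psi> x) = L \<phi> + L \<psi>) \<and>
     (\<forall>c. \<forall>\<phi>\<in>E_space p q. L (\<lambda>x. c * \<phi> x) = c * L \<phi>) \<and>
     (\<exists>C N. \<forall>\<phi>\<in>E_space p q. \<bar>L \<phi>\<bar> \<le> C * (\<Sum>k\<le>N. E_seminorm p q k \<phi>))}"

definition weak_star_tendsto ::
    "real \<Rightarrow> real \<Rightarrow> (real \<Rightarrow> (real \<Rightarrow> real) \<Rightarrow> real) \<Rightarrow> ((real \<Rightarrow> real) \<Rightarrow> real) \<Rightarrow> real filter \<Rightarrow> bool" where
  "weak_star_tendsto p q L L0 F \<longleftrightarrow>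
     (\<forall>\<^sub>F t in F. L t \<in> E_dual p q) \<and> L0 \<in> E_dual p q \<and>
     (\<forall>\<phi>\<in>E_space p q. ((\<lambda>t. L t \<phi>) \<longlongrightarrow> L0 \<phi>) F)"

definition measure_functional :: "real measure \<Rightarrow> (real \<Rightarrow> real) \<Rightarrow> real" where
  "measure_functional m \<phi> = (LINT x|m. \<phi> x)"

end

theory Submission
  imports Defs
begin

text \<open>Testing the equation with \<open>\<eta>(t) \<phi>(x)\<close> applies to \<open>\<phi>\<close> the operator
  \<open>L \<phi> (x) = x\<^sup>\<gamma> (x \<phi>'(x) - \<phi>(x) + (\<theta>/x) \<integral>\<^sub>0\<^sup>x \<phi>)\<close>. For \<open>p > -1\<close>, \<open>\<phi> = x\<^sup>p\<close> satisfies
  \<open>L \<phi> = c x\<^sup>p\<^sup>+\<^sup>\<gamma>\<close> with \<open>c > 0\<close>, but a naive cut-off at infinity destroys the sign. With \<open>z = ln x\<close> and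
  \<open>\<integral>\<^sub>0\<^sup>x \<phi> = x g(z)\<close> one gets \<open>L \<phi> = x\<^sup>\<gamma> (g'' + \<omega>\<^sup>2 g)\<close>, where \<open>\<omega>\<^sup>2 = \<theta> - 1 > 0\<close>. Since this operator
  oscillates, following a solution of \<open>g'' + \<omega>\<^sup>2 g = 0\<close> until \<open>\<phi>\<close> vanishes, and continuing by \<open>\<phi> = 0\<close>,
  gives cut-offs of \<open>x\<^sup>p\<close> with compact support in \<open>(0,\<infinity>)\<close> and \<open>L \<phi> \<ge> 0\<close> everywhere. For a non-negative
  solution they show that if the moment of order \<open>p\<close> on \<open>(1,\<infinity>)\<close> is locally integrable in time, so is
  the moment of order \<open>p + \<gamma>\<close>. By induction all high moments are integrable on compact subsets of
  \<open>(0,T)\<close>. But the Dirac mass gives the explicit solution moments at least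
  \<open>(1 - \<gamma> t)\<^bsup>(1-p)/\<gamma>\<^esup>\<close>, which is not integrable up to \<open>t = 1/\<gamma> < T\<close> when \<open>p \<ge> 1 + 2 \<gamma>\<close>.\<close>

section \<open>Cut-off powers\<close>

text \<open>Normalising at 0 makes the antiderivative vanish on the whole left half-line, because
  its derivative does. The profiles below are assembled from such antiderivatives, so their supports
  start at \<open>z = 0\<close>, that is at \<open>x = 1\<close>.\<close>

lemma continuous_antiderivative:
  fixes k :: "real \<Rightarrow> real"
  assumes "continuous_on UNIV k" and "\<And>z. z \<le> 0 \<Longrightarrow> k z = 0"
  obtains K where "\<And>z. (K has_real_derivative k z) (at z)" and "\<And>z. z \<le> 0 \<Longrightarrow> K z = 0"
proof -
  have "\<exists>F. \<forall>x::real. -\<infinity> < ereal x \<longrightarrow> ereal x < \<infinity> \<longrightarrow> (F has_vector_derivative k x) (at x)"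
    using assms(1) by (intro einterval_antiderivative) (auto simp: continuous_on_eq_continuous_at)
  then obtain F where F: "\<And>z. (F has_real_derivative k z) (at z)"
    by (auto simp: has_real_derivative_iff_has_vector_derivative)
  have F0: "F z = F 0" if "z \<le> 0" for z
  proof (cases "z = 0")
    case False
    then have "z < 0" using that by simp
    from MVT2[OF this F] obtain c where "c < 0" "F 0 - F z = (0 - z) * k c"
      by blast
    then show ?thesis using assms(2) by simp
  qed simp
  show ?thesis
  proof (rule that[of "\<lambda>z. F z - F 0"])
    show "((\<lambda>z. F z - F 0) has_real_derivative k z) (at z)" for z
      by (auto intro!: derivative_eq_intros F)
    show "F z - F 0 = 0" if "z \<le> 0" for z
      using F0[OF that] by simp
  qed
qed

text \<open>The amplitude-phase form puts the first positive zero of the kernel \<open>b\<close> at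
  total phase \<open>pi\<close>, which is the equation defining \<tau>, and turns a shift by \<tau>
  into a half-turn.\<close>

lemma sin_plus_cos_arctan:
  fixes \<omega> s :: real
  shows "sin s + \<omega> * cos s = sqrt (1 + \<omega>\<^sup>2) * sin (s + arctan \<omega>)"
proof -
  have "sqrt (1 + \<omega>\<^sup>2) \<noteq> 0"
    by (smt (verit) real_sqrt_eq_zero_cancel_iff zero_le_power2)
  then show ?thesis
    by (simp add: sin_add sin_arctan cos_arctan field_simps)
qed

text \<open>Here \<open>f\<close> is the convolution of \<open>\<mu>\<close> with \<open>b s = sin (\<omega> s) + \<omega> cos (\<omega> s)\<close> restricted to \<open>[0,\<tau>]\<close>, and
  \<open>\<tau>\<close> is the first positive zero of \<open>b\<close>.\<close>

lemma cutoff_profile: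
  fixes \<omega> \<tau> :: real and \<mu> :: "real \<Rightarrow> real"
  assumes \<omega>: "\<omega> > 0" and \<tau>: "\<omega> * \<tau> = pi - arctan \<omega>"
    and \<mu>: "continuous_on UNIV \<mu>" "\<And>z. \<mu> z \<ge> 0" "\<And>z. z \<le> 0 \<Longrightarrow> \<mu> z = 0"
  obtains f f' g where
    "\<And>z. (f has_real_derivative f' z) (at z)" "continuous_on UNIV f'"
    "\<And>z. ((\<lambda>z. exp z * g z) has_real_derivative exp z * f z) (at z)"
    "\<And>z. z \<le> 0 \<Longrightarrow> f z = 0" "\<And>z. z \<le> 0 \<Longrightarrow> g z = 0"
    "\<And>z. f z \<ge> 0"
    "\<And>z M. (\<And>a. z - \<tau> < a \<Longrightarrow> a < z \<Longrightarrow> \<mu> a \<le> M) \<Longrightarrow> f z \<le> \<tau> * (1 + \<omega>) * M"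
    "\<And>z. f' z - f z + (1 + \<omega>\<^sup>2) * g z \<ge> \<omega> * \<mu> z"
proof -
  define \<kappa> where "\<kappa> = sqrt (1 + \<omega>\<^sup>2)"
  have \<kappa>: "\<kappa> * \<kappa> = 1 + \<omega>\<^sup>2" "\<kappa> > 0"
    by (simp_all add: \<kappa>_def add_pos_nonneg)
  have \<tau>0: "\<tau> > 0"
  proof -
    have "\<omega> * \<tau> > 0" using \<tau> arctan_ubound[of \<omega>] pi_gt_zero by linarith
    then show ?thesis using \<omega> by (simp add: zero_less_mult_iff)
  qed
  have [continuous_intros]: "continuous_on S \<mu>" for S
    using \<mu>(1) continuous_on_subset by blast
  obtain A where A: "\<And>z. (A has_real_derivative cos (\<omega> * z) * \<mu> z) (at z)" "\<And>z. z \<le> 0 \<Longrightarrow> A z = 0"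
    by (rule continuous_antiderivative[of "\<lambda>z. cos (\<omega> * z) * \<mu> z"]) (auto intro!: continuous_intros \<mu>)
  obtain B where B: "\<And>z. (B has_real_derivative sin (\<omega> * z) * \<mu> z) (at z)" "\<And>z. z \<le> 0 \<Longrightarrow> B z = 0"
    by (rule continuous_antiderivative[of "\<lambda>z. sin (\<omega> * z) * \<mu> z"]) (auto intro!: continuous_intros \<mu>)
  obtain E where E: "\<And>z. (E has_real_derivative exp z * \<mu> z) (at z)" "\<And>z. z \<le> 0 \<Longrightarrow> E z = 0"
    by (rule continuous_antiderivative[of "\<lambda>z. exp z * \<mu> z"]) (auto intro!: continuous_intros \<mu>)
  have E0: "E z \<ge> 0" for z
  proof (cases "z \<le> 0")
    case False
    then have "E 0 \<le> E z"
      using E \<mu>(2) by (intro DERIV_nonneg_imp_nondecreasing[of 0 z E]) (auto intro!: exI mult_nonneg_nonneg)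
    then show ?thesis using E by simp
  qed (use E in simp)
  \<comment> \<open>\<open>U\<close> is the convolution of \<mu> with
    \<open>sin (\<omega> * s)\<close> on \<open>s \<ge> 0\<close>, hence the solution of
    \<open>U'' + \<omega>\<^sup>2 * U = \<omega> * \<mu>\<close> that vanishes for
    \<open>z \<le> 0\<close>.\<close>
  define U where "U z = sin (\<omega> * z) * A z - cos (\<omega> * z) * B z" for z
  define U' where "U' z = \<omega> * (cos (\<omega> * z) * A z + sin (\<omega> * z) * B z)" for z
  have U: "(U has_real_derivative U' z) (at z)" for z
    unfolding U_def U'_def
    by (auto intro!: derivative_eq_intros A B simp: algebra_simps)
  have U'': "(U' has_real_derivative \<omega> * \<mu> z - \<omega>\<^sup>2 * U z) (at z)" for z
  proof -
    have "(U' has_real_derivative \<omega> * ((cos (\<omega> * z) * (cos (\<omega> * z) * \<mu> z) - sin (\<omega> * z) * \<omega> * A z)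
       + (sin (\<omega> * z) * (sin (\<omega> * z) * \<mu> z) + cos (\<omega> * z) * \<omega> * B z))) (at z)"
      unfolding U'_def by (auto intro!: derivative_eq_intros A B simp: algebra_simps)
    moreover have "\<omega> * ((c * (c * m) - s * \<omega> * a) + (s * (s * m) + c * \<omega> * b)) = \<omega> * m - \<omega>\<^sup>2 * (s * a - c * b)"
      if "s\<^sup>2 + c\<^sup>2 = 1" for s c m a b :: real
    proof -
      have "c * (c * m) + s * (s * m) = (s\<^sup>2 + c\<^sup>2) * m"
        by (simp add: power2_eq_square algebra_simps)
      then have "c * (c * m) + s * (s * m) = m" using that by simp
      then have "\<omega> * (c * (c * m) + s * (s * m)) = \<omega> * m" by simp
      then show ?thesis by (simp add: power2_eq_square algebra_simps)
    qed
    ultimately show ?thesis unfolding U_def by simp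
  qed
  have shift: "((\<lambda>z. F (z - \<tau>)) has_real_derivative F' (z - \<tau>)) (at z)"
    if "\<And>z. (F has_real_derivative F' z) (at z)" for F F' :: "real \<Rightarrow> real" and z
    using that[of "z - \<tau>"] DERIV_shift[of F _ z "- \<tau>"] by simp
  \<comment> \<open>\<open>U + U'\<close> is the convolution with the untruncated \<open>b\<close>.
    Past its zero, \<open>b (\<tau> + r) = - \<kappa> * sin (\<omega> * r)\<close>, so cutting the
    kernel at \<tau> amounts to adding \<open>\<kappa> * U (z - \<tau>)\<close>.\<close>
  define f where "f z = U z + U' z + \<kappa> * U (z - \<tau>)" for z
  define f' where "f' z = U' z + (\<omega> * \<mu> z - \<omega>\<^sup>2 * U z) + \<kappa> * U' (z - \<tau>)" for z
  \<comment> \<open>The function \<open>g\<close> has to solve \<open>g' + g = f\<close>. The part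
    \<open>U + U'\<close> of \<open>f\<close> contributes \<open>U\<close>; the shifted part needs a
    solution of \<open>J' + J = U\<close>, which partial fractions build from
    \<open>W' + W = \<mu>\<close> and the oscillator equation for \<open>U\<close>.\<close>
  define W where "W z = exp (- z) * E z" for z
  define J where "J z = (\<omega> * W z - U' z + U z) / (1 + \<omega>\<^sup>2)" for z
  define g where "g z = U z + \<kappa> * J (z - \<tau>)" for z
  have ff: "(f has_real_derivative f' z) (at z)" for z
    unfolding f_def f'_def by (auto intro!: derivative_eq_intros U U'' shift)
  have "(U has_real_derivative U' z) (at z within S)"
       "(U' has_real_derivative \<omega> * \<mu> z - \<omega>\<^sup>2 * U z) (at z within S)" for z S
    using U[of z] U''[of z] by (auto intro: has_field_derivative_at_within)
  then have [continuous_intros]: "continuous_on S U" "continuous_on S U'" for S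
    by (auto intro!: DERIV_continuous_on)
  have UU: "continuous_on UNIV (\<lambda>z. U' (z - \<tau>))"
    by (rule continuous_on_compose2[of UNIV U']) (auto intro!: continuous_intros)
  have f'c: "continuous_on UNIV f'"
    unfolding f'_def by (intro continuous_intros UU)
  have nz: "1 + \<omega>\<^sup>2 \<noteq> 0" using \<kappa> by (smt (verit) zero_le_power2)
  have eEd: "(W has_real_derivative \<mu> z - W z) (at z)" for z
    unfolding W_def by (auto intro!: derivative_eq_intros E simp: exp_minus field_simps)
  have J': "(J has_real_derivative U z - J z) (at z)" for z
  proof -
    have "(J has_real_derivative (\<omega> * (\<mu> z - W z) - (\<omega> * \<mu> z - \<omega>\<^sup>2 * U z) + U' z) / (1 + \<omega>\<^sup>2)) (at z)"
      unfolding J_def using nz by (auto intro!: derivative_eq_intros eEd U U'')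
    moreover have "(\<omega> * (\<mu> z - W z) - (\<omega> * \<mu> z - \<omega>\<^sup>2 * U z) + U' z) / (1 + \<omega>\<^sup>2) = U z - J z"
      unfolding J_def using nz by (auto simp: field_simps)
    ultimately show ?thesis by simp
  qed
  have gd: "(g has_real_derivative U' z + \<kappa> * (U (z - \<tau>) - J (z - \<tau>))) (at z)" for z
    unfolding g_def
    by (auto intro!: derivative_eq_intros U shift[where F = J and F' = "\<lambda>z. U z - J z"] J')
  have gg: "((\<lambda>z. exp z * g z) has_real_derivative exp z * f z) (at z)" for z
    by (rule derivative_eq_intros DERIV_exp gd refl)+ (simp add: g_def f_def algebra_simps)
  \<comment> \<open>Since \<open>f = g' + g\<close>, the left-hand side is
    \<open>g'' + \<omega>\<^sup>2 * g\<close>. The oscillating terms cancel; truncation leaves only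
    a multiple of \<open>W (z - \<tau>)\<close>, which has the favourable sign.\<close>
  have low: "f' z - f z + (1 + \<omega>\<^sup>2) * g z \<ge> \<omega> * \<mu> z" for z
  proof -
    have J: "(1 + \<omega>\<^sup>2) * J (z - \<tau>) = \<omega> * W (z - \<tau>) - U' (z - \<tau>) + U (z - \<tau>)"
      using nz by (simp add: J_def)
    have "(1 + \<omega>\<^sup>2) * g z = (1 + \<omega>\<^sup>2) * U z + \<kappa> * ((1 + \<omega>\<^sup>2) * J (z - \<tau>))"
      by (simp add: g_def algebra_simps)
    then have "f' z - f z + (1 + \<omega>\<^sup>2) * g z = \<omega> * \<mu> z + \<kappa> * (\<omega> * W (z - \<tau>))"
      unfolding f_def f'_def J by (simp add: algebra_simps)
    moreover have "\<kappa> * (\<omega> * W (z - \<tau>)) \<ge> 0"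
      using \<kappa> \<omega> E0[of "z - \<tau>"] by (simp add: W_def)
    ultimately show ?thesis by simp
  qed
  define b where "b s = sin (\<omega> * s) + \<omega> * cos (\<omega> * s)" for s
  have b_alt: "b s = \<kappa> * sin (\<omega> * s + arctan \<omega>)" for s
    unfolding b_def \<kappa>_def by (rule sin_plus_cos_arctan)
  have b0: "b s \<ge> 0" if "0 \<le> s" "s \<le> \<tau>" for s
  proof -
    have "\<omega> * s \<le> \<omega> * \<tau>" "0 \<le> \<omega> * s" using that \<omega> by auto
    then have "\<omega> * s + arctan \<omega> \<le> pi" "0 \<le> \<omega> * s + arctan \<omega>"
      using \<tau> \<omega> by (auto simp: add_nonneg_nonneg)
    then show ?thesis unfolding b_alt using \<kappa> by (simp add: sin_ge_zero)
  qed
  have b1: "b s \<le> 1 + \<omega>" for s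
    unfolding b_def using \<omega> by (intro add_mono) auto
  \<comment> \<open>The mean value theorem for an antiderivative in \<open>a\<close> of
    \<open>b (z - a) * \<mu> a\<close>, on an interval of length \<tau>, replaces the convolution
    integral: sign and size of \<open>f z\<close> are read off one value of the integrand.\<close>
  have mvt: "\<exists>a. z - \<tau> < a \<and> a < z \<and> f z = \<tau> * (b (z - a) * \<mu> a)" for z
  proof -
    define G where "G a = (sin (\<omega> * z) + \<omega> * cos (\<omega> * z)) * A a + (\<omega> * sin (\<omega> * z) - cos (\<omega> * z)) * B a" for a
    have G: "(G has_real_derivative b (z - a) * \<mu> a) (at a)" for a
    proof -
      have "b (z - a) * \<mu> a = (sin (\<omega> * z) + \<omega> * cos (\<omega> * z)) * (cos (\<omega> * a) * \<mu> a)
          + (\<omega> * sin (\<omega> * z) - cos (\<omega> * z)) * (sin (\<omega> * a) * \<mu> a)"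
        unfolding b_def by (simp add: right_diff_distrib sin_diff cos_diff) (simp add: algebra_simps)
      then show ?thesis unfolding G_def
        by (auto intro!: derivative_eq_intros A B)
    qed
    obtain a where a: "z - \<tau> < a" "a < z" "G z - G (z - \<tau>) = (z - (z - \<tau>)) * (b (z - a) * \<mu> a)"
      using MVT2[of "z - \<tau>" z G "\<lambda>a. b (z - a) * \<mu> a"] G \<tau>0 by auto
    have arg: "\<omega> * (z - \<tau>) = (\<omega> * z + arctan \<omega>) - pi"
      using \<tau> by (simp add: right_diff_distrib)
    have s: "sin (\<omega> * (z - \<tau>)) = - sin (\<omega> * z + arctan \<omega>)" "cos (\<omega> * (z - \<tau>)) = - cos (\<omega> * z + arctan \<omega>)"
      unfolding arg by simp_all
    have k1: "\<kappa> * sin (\<omega> * z + arctan \<omega>) = sin (\<omega> * z) + \<omega> * cos (\<omega> * z)"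
      unfolding \<kappa>_def sin_plus_cos_arctan by simp
    \<comment> \<open>The cosine version comes from the amplitude-phase identity with the argument
      advanced by a quarter turn.\<close>
    have "\<kappa> * cos (\<omega> * z + arctan \<omega>) = \<kappa> * sin ((\<omega> * z + pi/2) + arctan \<omega>)"
      using sin_add[of "\<omega> * z + arctan \<omega>" "pi / 2"] by (simp add: add_ac)
    also have "\<dots> = sin (\<omega> * z + pi/2) + \<omega> * cos (\<omega> * z + pi/2)"
      unfolding \<kappa>_def sin_plus_cos_arctan by simp
    finally have k2: "\<kappa> * cos (\<omega> * z + arctan \<omega>) = cos (\<omega> * z) - \<omega> * sin (\<omega> * z)"
      by (simp add: sin_add cos_add)
    have "\<kappa> * U (z - \<tau>) = - ((\<kappa> * sin (\<omega> * z + arctan \<omega>)) * A (z - \<tau>))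
        + (\<kappa> * cos (\<omega> * z + arctan \<omega>)) * B (z - \<tau>)"
      unfolding U_def s by (simp add: right_diff_distrib mult.assoc)
    then have "\<kappa> * U (z - \<tau>) = - G (z - \<tau>)"
      unfolding k1 k2 G_def by (simp add: algebra_simps)
    moreover have "U z + U' z = G z"
      unfolding U_def U'_def G_def by (simp add: algebra_simps)
    ultimately have "f z = G z - G (z - \<tau>)"
      by (simp add: f_def)
    with a show ?thesis by auto
  qed
  show ?thesis
  proof (rule that[OF ff f'c gg _ _ _ _ low])
    show "f z = 0" if "z \<le> 0" for z
      using that A B \<tau>0 by (simp add: f_def U_def U'_def)
    show "g z = 0" if "z \<le> 0" for z
      using that A B E \<tau>0 by (simp add: g_def U_def U'_def J_def W_def)
    show "f z \<ge> 0" for z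
    proof -
      obtain a where "z - \<tau> < a" "a < z" "f z = \<tau> * (b (z - a) * \<mu> a)" using mvt by blast
      then show ?thesis using b0[of "z - a"] \<mu>(2)[of a] \<tau>0 by simp
    qed
    show "f z \<le> \<tau> * (1 + \<omega>) * M" if M: "\<And>a. z - \<tau> < a \<Longrightarrow> a < z \<Longrightarrow> \<mu> a \<le> M" for z M
    proof -
      obtain a where a: "z - \<tau> < a" "a < z" "f z = \<tau> * (b (z - a) * \<mu> a)" using mvt by blast
      have "b (z - a) * \<mu> a \<le> (1 + \<omega>) * M"
        using b1[of "z - a"] M[OF a(1,2)] \<mu>(2)[of a] \<omega> by (intro mult_mono) auto
      then show ?thesis using a \<tau>0 by (simp add: mult.assoc)
    qed
  qed
qed

section \<open>The profile as a test function on the half-line\<close>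

text \<open>The profile of \<open>cutoff_profile\<close> is read at \<open>ln x\<close>. The order
  of quantifiers matters: \<omega> and \<open>C\<close> are fixed before \<mu> and \<open>N\<close>,
  so the cut-off can be pushed to infinity without spoiling the estimates.\<close>

lemma cutoff_test_function:
  fixes \<gamma> \<theta> p :: real
  assumes \<theta>: "\<theta> > 1"
  obtains \<omega> C where "\<omega> > 0" "C \<ge> 0"
    "\<And>\<mu> N. continuous_on UNIV \<mu> \<Longrightarrow> (\<And>z. 0 \<le> \<mu> z) \<Longrightarrow> (\<And>z. \<mu> z \<le> exp (p * z)) \<Longrightarrow>
      (\<And>z. z \<le> 0 \<Longrightarrow> \<mu> z = 0) \<Longrightarrow> (\<And>z. z \<ge> N \<Longrightarrow> \<mu> z = 0) \<Longrightarrow>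
      \<exists>\<phi> \<phi>' X. (\<forall>x. (\<phi> has_real_derivative \<phi>' x) (at x)) \<and> continuous_on UNIV \<phi>' \<and>
        (\<forall>x. x \<notin> {1<..X} \<longrightarrow> \<phi> x = 0) \<and> (\<forall>x. 0 \<le> \<phi> x) \<and> (\<forall>x>0. \<phi> x \<le> C * x powr p) \<and>
        (\<forall>y>0. \<omega> * (y powr \<gamma> * \<mu> (ln y)) \<le>
           y powr (\<gamma> + 1) * \<phi>' y - y powr \<gamma> * \<phi> y + \<theta> * (y powr (\<gamma> - 1) * (LBINT x:{0<..<y}. \<phi> x)))"
proof -
  define \<omega> where "\<omega> = sqrt (\<theta> - 1)"
  have \<omega>: "\<omega> > 0" "1 + \<omega>\<^sup>2 = \<theta>" using \<theta> by (simp_all add: \<omega>_def)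
  define \<tau> where "\<tau> = (pi - arctan \<omega>) / \<omega>"
  have \<tau>: "\<omega> * \<tau> = pi - arctan \<omega>" using \<omega> by (simp add: \<tau>_def)
  have \<tau>0: "\<tau> > 0"
    unfolding \<tau>_def using \<omega> arctan_ubound[of \<omega>] pi_gt_zero by (intro divide_pos_pos) linarith+
  \<comment> \<open>The size of \<open>f\<close> at \<open>ln x\<close> depends on \<mu> over a
    window of length \<tau> ending there, in which \<open>exp (p * z)\<close> exceeds
    \<open>x powr p\<close> at most by the factor
    \<open>exp (\<bar>p\<bar> * \<tau>)\<close>.\<close>
  define C where "C = \<tau> * (1 + \<omega>) * exp (\<bar>p\<bar> * \<tau>)"
  have C0: "C \<ge> 0" unfolding C_def using \<tau>0 \<omega> by simp
  show ?thesis
  proof (rule that[OF \<omega>(1) C0])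
    fix \<mu> :: "real \<Rightarrow> real" and N
    assume \<mu>: "continuous_on UNIV \<mu>" "\<And>z. 0 \<le> \<mu> z" "\<And>z. \<mu> z \<le> exp (p * z)"
      "\<And>z. z \<le> 0 \<Longrightarrow> \<mu> z = 0" "\<And>z. z \<ge> N \<Longrightarrow> \<mu> z = 0"
    obtain f f' g where
      f: "\<And>z. (f has_real_derivative f' z) (at z)" "continuous_on UNIV f'"
      and g: "\<And>z. ((\<lambda>z. exp z * g z) has_real_derivative exp z * f z) (at z)"
      and z0: "\<And>z. z \<le> 0 \<Longrightarrow> f z = 0" "\<And>z. z \<le> 0 \<Longrightarrow> g z = 0"
      and f0: "\<And>z. f z \<ge> 0"
      and fM: "\<And>z M. (\<And>a. z - \<tau> < a \<Longrightarrow> a < z \<Longrightarrow> \<mu> a \<le> M) \<Longrightarrow> f z \<le> \<tau> * (1 + \<omega>) * M"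
      and low: "\<And>z. f' z - f z + (1 + \<omega>\<^sup>2) * g z \<ge> \<omega> * \<mu> z"
    proof (rule cutoff_profile[OF \<omega>(1) \<tau> \<mu>(1,2)], goal_cases)
      case (1 z)
      then show ?case using \<mu>(4) by simp
    next
      case (2 f f' g)
      show ?case by (rule 2(1)[OF 2(2-9)])
    qed
    \<comment> \<open>A zero of a non-negative function is a minimum. This makes the extension of
      \<phi> by zero below \<open>x = 1\<close> continuously differentiable.\<close>
    have f'0: "f' z = 0" if "f z = 0" for z
      using DERIV_local_min[OF f(1), of 1] f0 that by auto
    define \<phi> where "\<phi> x = (if x > 0 then f (ln x) else 0)" for x
    define \<phi>' where "\<phi>' x = (if x > 0 then f' (ln x) / x else 0)" for x
    \<comment> \<open>\<open>P\<close> is the antiderivative of \<phi> vanishing at 0: in the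
      variable \<open>z = ln x\<close> it is \<open>exp z * g z\<close>. It evaluates the nonlocal
      term in closed form.\<close>
    define P where "P x = (if x > 0 then x * g (ln x) else 0)" for x
    have small: "\<phi> x = 0" "\<phi>' x = 0" "P x = 0" if "x < 1" for x
      using that z0 f'0 by (auto simp: \<phi>_def \<phi>'_def P_def)
    have D\<phi>: "(\<phi> has_real_derivative \<phi>' x) (at x)" for x
    proof (cases "x > 0")
      case True
      then have "((\<lambda>x. f (ln x)) has_real_derivative \<phi>' x) (at x)"
        using DERIV_chain2[of f "f' (ln x)" ln x, OF f(1) DERIV_ln_divide] by (simp add: \<phi>'_def)
      then show ?thesis
        by (rule has_field_derivative_transform_within_open[of _ _ _ "{0<..}"])
          (use True in \<open>auto simp: \<phi>_def\<close>)
    next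
      case False
      then have "((\<lambda>x. 0) has_real_derivative \<phi>' x) (at x)"
        by (auto simp: \<phi>'_def)
      then show ?thesis
        by (rule has_field_derivative_transform_within_open[of _ _ _ "{..<1}"])
          (use False small in auto)
    qed
    have DP: "(P has_real_derivative \<phi> x) (at x)" for x
    proof (cases "x > 0")
      case True
      then have "((\<lambda>x. exp (ln x) * g (ln x)) has_real_derivative \<phi> x) (at x)"
        using DERIV_chain2[of "\<lambda>z. exp z * g z" "exp (ln x) * f (ln x)" ln x, OF g DERIV_ln_divide]
        by (simp add: \<phi>_def)
      then show ?thesis
        by (rule has_field_derivative_transform_within_open[of _ _ _ "{0<..}"])
          (use True in \<open>auto simp: P_def\<close>)
    next
      case False
      then have "((\<lambda>x. 0) has_real_derivative \<phi> x) (at x)"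
        by (auto simp: \<phi>_def)
      then show ?thesis
        by (rule has_field_derivative_transform_within_open[of _ _ _ "{..<1}"])
          (use False small in auto)
    qed
    have "continuous_on ({0<..} \<union> {..<1}) \<phi>'"
    proof (rule continuous_on_open_Un)
      have "continuous_on {0<..} (\<lambda>x. f' (ln x) / x)"
        by (auto intro!: continuous_intros continuous_on_compose2[OF f(2)])
      then show "continuous_on {0<..} \<phi>'"
        by (rule continuous_on_eq) (auto simp: \<phi>'_def)
      show "continuous_on {..<1} \<phi>'"
        by (rule continuous_on_eq[OF continuous_on_const[of _ 0]]) (use small in auto)
    qed auto
    moreover have "{0<..} \<union> {..<1} = (UNIV :: real set)" by auto
    ultimately have c\<phi>': "continuous_on UNIV \<phi>'" by simp
    have c\<phi>: "isCont \<phi> x" for x using D\<phi> DERIV_isCont by blast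
    have int: "(LBINT x:{0<..<y}. \<phi> x) = y * g (ln y)" if y: "y > 0" for y
    proof -
      have "(LBINT x:{0<..<y}. \<phi> x) = (\<integral>x. \<phi> x * indicator {0..y} x \<partial>lborel)"
        unfolding set_lebesgue_integral_def
      proof (rule integral_cong_AE)
        have [measurable]: "\<phi> \<in> borel_measurable borel"
          using c\<phi> by (intro borel_measurable_continuous_onI continuous_at_imp_continuous_on) auto
        show "(\<lambda>x. indicator {0<..<y} x *\<^sub>R \<phi> x) \<in> borel_measurable lborel"
          "(\<lambda>x. \<phi> x * indicator {0..y} x) \<in> borel_measurable lborel"
          by measurable
        show "AE x in lborel. indicator {0<..<y} x *\<^sub>R \<phi> x = \<phi> x * indicator {0..y} x"
          using AE_lborel_singleton[of y]
          by eventually_elim (auto simp: indicator_def \<phi>_def)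
      qed
      also have "\<dots> = P y - P 0"
        using y by (intro integral_FTC_Icc_real DP c\<phi>) auto
      finally show ?thesis using y by (simp add: P_def)
    qed
    have up: "\<phi> x \<le> C * x powr p" if x: "x > 0" for x
    proof -
      have "\<mu> a \<le> exp (\<bar>p\<bar> * \<tau>) * x powr p" if a: "ln x - \<tau> < a" "a < ln x" for a
      proof -
        have "p * (a - ln x) \<le> \<bar>p\<bar> * \<bar>a - ln x\<bar>"
          by (metis abs_ge_self abs_mult)
        also have "\<dots> \<le> \<bar>p\<bar> * \<tau>"
          using a by (intro mult_left_mono) auto
        finally have "p * a \<le> \<bar>p\<bar> * \<tau> + p * ln x"
          by (simp add: right_diff_distrib)
        then have "exp (p * a) \<le> exp (\<bar>p\<bar> * \<tau>) * x powr p"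
          using x by (simp add: powr_def exp_add[symmetric])
        then show ?thesis using \<mu>(3)[of a] by linarith
      qed
      then have "f (ln x) \<le> \<tau> * (1 + \<omega>) * (exp (\<bar>p\<bar> * \<tau>) * x powr p)"
        by (rule fM)
      then show ?thesis using x by (simp add: \<phi>_def C_def mult.assoc)
    qed
    \<comment> \<open>Beyond \<open>exp (N + \<tau>)\<close> the whole window lies where \<mu>
      vanishes, so the upper bound on \<open>f\<close> holds with \<open>M = 0\<close>.\<close>
    have large: "\<phi> x = 0" if "x > exp (N + \<tau>)" for x
    proof -
      have "x > 0" using that exp_gt_zero[of "N + \<tau>"] by linarith
      then have "ln x > N + \<tau>" using that by (metis exp_less_cancel_iff exp_ln)
      then have "f (ln x) \<le> \<tau> * (1 + \<omega>) * 0"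
        by (intro fM) (simp add: \<mu>(5))
      then show ?thesis using f0[of "ln x"] by (simp add: \<phi>_def)
    qed
    have L: "\<omega> * (y powr \<gamma> * \<mu> (ln y)) \<le>
       y powr (\<gamma> + 1) * \<phi>' y - y powr \<gamma> * \<phi> y + \<theta> * (y powr (\<gamma> - 1) * (LBINT x:{0<..<y}. \<phi> x))"
      if y: "y > 0" for y
    proof -
      have "y powr \<gamma> * (\<omega> * \<mu> (ln y)) \<le> y powr \<gamma> * (f' (ln y) - f (ln y) + \<theta> * g (ln y))"
        using low[of "ln y"] \<omega> by (intro mult_left_mono) auto
      also have "\<dots> = y powr (\<gamma> + 1) * \<phi>' y - y powr \<gamma> * \<phi> y + \<theta> * (y powr (\<gamma> - 1) * (y * g (ln y)))"
        using y by (simp add: \<phi>_def \<phi>'_def powr_add powr_diff algebra_simps)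
      finally show ?thesis unfolding int[OF y] by (simp add: mult_ac)
    qed
    show "\<exists>\<phi> \<phi>' X. (\<forall>x. (\<phi> has_real_derivative \<phi>' x) (at x)) \<and> continuous_on UNIV \<phi>' \<and>
        (\<forall>x. x \<notin> {1<..X} \<longrightarrow> \<phi> x = 0) \<and> (\<forall>x. 0 \<le> \<phi> x) \<and> (\<forall>x>0. \<phi> x \<le> C * x powr p) \<and>
        (\<forall>y>0. \<omega> * (y powr \<gamma> * \<mu> (ln y)) \<le>
           y powr (\<gamma> + 1) * \<phi>' y - y powr \<gamma> * \<phi> y + \<theta> * (y powr (\<gamma> - 1) * (LBINT x:{0<..<y}. \<phi> x)))"
    proof (intro exI conjI allI impI)
      show "\<phi> x = 0" if "x \<notin> {1<..exp (N + \<tau>)}" for x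
        using that z0(1)[of "ln x"] large[of x] by (auto simp: \<phi>_def not_le)
      show "0 \<le> \<phi> x" for x using f0 by (simp add: \<phi>_def)
    qed (use D\<phi> c\<phi>' up L in auto)
  qed
qed

section \<open>The weak formulation for solutions with a finite moment\<close>

text \<open>A measure curve comes with measurability in time of the masses of fixed sets; the
  standard induction on non-negative measurable functions carries this over to integrals.\<close>

lemma nn_integral_measurable_family:
  assumes sets: "\<And>t. t \<in> space N \<Longrightarrow> sets (w t) = sets M"
    and meas: "\<And>A. A \<in> sets M \<Longrightarrow> (\<lambda>t. emeasure (w t) A) \<in> borel_measurable N"
    and f: "(f :: 'a \<Rightarrow> ennreal) \<in> borel_measurable M"
  shows "(\<lambda>t. \<integral>\<^sup>+x. f x \<partial>w t) \<in> borel_measurable N"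
proof -
  have bm: "borel_measurable (w t) = (borel_measurable M :: ('a \<Rightarrow> ennreal) set)" if "t \<in> space N" for t
    by (rule measurable_cong_sets[OF sets[OF that] refl])
  show ?thesis using f
  proof (induction rule: borel_measurable_induct)
    case (cong f g)
    have "(\<integral>\<^sup>+x. f x \<partial>w t) = (\<integral>\<^sup>+x. g x \<partial>w t)" if "t \<in> space N" for t
      using cong(3) sets_eq_imp_space_eq[OF sets[OF that]] by (intro nn_integral_cong) auto
    then show ?case using cong(4) by (simp cong: measurable_cong)
  next
    case (set A)
    have "(\<integral>\<^sup>+x. indicator A x \<partial>w t) = emeasure (w t) A" if "t \<in> space N" for t
      using set sets[OF that] by simp
    then show ?case using meas[OF set] by (simp cong: measurable_cong)
  next
    case (mult u c)
    have "(\<integral>\<^sup>+x. c * u x \<partial>w t) = c * (\<integral>\<^sup>+x. u x \<partial>w t)" if "t \<in> space N" for t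
      using mult(2) bm[OF that] by (intro nn_integral_cmult) auto
    then show ?case using mult(4) by (simp cong: measurable_cong)
  next
    case (add u v)
    have "(\<integral>\<^sup>+x. v x + u x \<partial>w t) = (\<integral>\<^sup>+x. v x \<partial>w t) + (\<integral>\<^sup>+x. u x \<partial>w t)" if "t \<in> space N" for t
      using add.hyps bm[OF that] by (intro nn_integral_add) auto
    then show ?case using add.IH by (simp cong: measurable_cong)
  next
    case (seq U)
    have "(\<integral>\<^sup>+x. (SUP i. U i) x \<partial>w t) = (SUP i. \<integral>\<^sup>+x. U i x \<partial>w t)" if "t \<in> space N" for t
      using nn_integral_monotone_convergence_SUP[of U "w t"] seq.hyps bm[OF that]
      by (simp add: image_comp)
    then show ?case using seq.IH seq.hyps by (simp cong: measurable_cong)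
  qed
qed

lemma integral_measurable_family:
  fixes f :: "'a \<Rightarrow> real"
  assumes sets: "\<And>t. t \<in> space N \<Longrightarrow> sets (w t) = sets M"
    and meas: "\<And>A. A \<in> sets M \<Longrightarrow> (\<lambda>t. emeasure (w t) A) \<in> borel_measurable N"
    and f: "f \<in> borel_measurable M" and int: "\<And>t. t \<in> space N \<Longrightarrow> integrable (w t) f"
  shows "(\<lambda>t. LINT x|w t. f x) \<in> borel_measurable N"
proof -
  have [measurable]: "(\<lambda>t. \<integral>\<^sup>+x. ennreal (f x) \<partial>w t) \<in> borel_measurable N"
    "(\<lambda>t. \<integral>\<^sup>+x. ennreal (- f x) \<partial>w t) \<in> borel_measurable N"
    using f by (auto intro!: nn_integral_measurable_family[OF sets meas])
  have "(\<lambda>t. enn2real (\<integral>\<^sup>+x. ennreal (f x) \<partial>w t) - enn2real (\<integral>\<^sup>+x. ennreal (- f x) \<partial>w t)) \<in> borel_measurable N"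
    by measurable
  then show ?thesis
    by (simp add: real_lebesgue_integral_def[OF int] cong: measurable_cong)
qed

lemma space_eq_halfline: "sets m = sets halfline \<Longrightarrow> space m = {0<..}"
  using sets_eq_imp_space_eq[of m halfline] by (simp add: space_restrict_space)

lemma borel_measurable_halfline:
  assumes "sets m = sets halfline" "f \<in> borel_measurable borel"
  shows "f \<in> borel_measurable m"
proof -
  have "f \<in> borel_measurable halfline"
    by (rule measurable_restrict_space1) (use assms(2) in simp)
  then show ?thesis
    by (simp add: measurable_cong_sets[OF assms(1) refl])
qed

text \<open>On the compact interval \<open>[1, X]\<close> every power is bounded away from zero.
  Hence a single finite moment, whatever its order, controls all compactly supported terms of the
  weak formulation.\<close>

lemma dominated_by_powr:
  fixes g :: "real \<Rightarrow> real"
  assumes "continuous_on {0<..} g" "\<And>x. x > 0 \<Longrightarrow> x \<notin> {1..X} \<Longrightarrow> g x = 0"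
  obtains G where "G \<ge> 0" "\<And>x. x > 0 \<Longrightarrow> \<bar>g x\<bar> \<le> G * x powr q"
proof -
  have "bounded ((\<lambda>x. g x * x powr (- q)) ` {1..X})"
    by (intro compact_imp_bounded compact_continuous_image continuous_intros
        continuous_on_subset[OF assms(1)]) auto
  then obtain G where G: "G > 0" "\<And>x. x \<in> {1..X} \<Longrightarrow> \<bar>g x * x powr (- q)\<bar> \<le> G"
    by (auto simp: bounded_pos)
  show ?thesis
  proof (rule that[of G])
    fix x :: real assume x: "x > 0"
    show "\<bar>g x\<bar> \<le> G * x powr q"
    proof (cases "x \<in> {1..X}")
      case True
      then show ?thesis using G(2)[OF True] x
        by (simp add: powr_minus abs_mult field_simps)
    qed (use assms(2)[of x] x G(1) in simp)
  qed (use G in simp)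
qed

section \<open>Separated test functions\<close>

text \<open>Squaring removes the corner of the positive part. Composed with the parabola
  \<open>(s - a) * (b - s)\<close>, this gives the time cut-off in
  \<open>moment_gain\<close>.\<close>

lemma square_pos_part_derivative:
  fixes y :: real
  shows "((\<lambda>y. (max 0 y)\<^sup>2) has_real_derivative 2 * max 0 y) (at y)"
proof (cases "y = 0")
  case False
  show ?thesis
  proof (cases "y > 0")
    case True
    have "((\<lambda>y. y\<^sup>2) has_real_derivative 2 * max 0 y) (at y)"
      using True by (auto intro!: derivative_eq_intros)
    then show ?thesis
      by (rule has_field_derivative_transform_within_open[of _ _ _ "{0<..}"]) (use True in auto)
  next
    case F: False
    have "((\<lambda>y. 0) has_real_derivative 2 * max 0 y) (at y)"
      using F by (auto intro!: derivative_eq_intros)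
    then show ?thesis
      by (rule has_field_derivative_transform_within_open[of _ _ _ "{..<0}"]) (use F False in auto)
  qed
next
  case True
  have "((\<lambda>h::real. (max 0 h)\<^sup>2 / h) \<longlongrightarrow> 0) (at 0)"
  proof (rule Lim_null_comparison)
    show "\<forall>\<^sub>F h in at 0. norm ((max 0 h)\<^sup>2 / h) \<le> \<bar>h::real\<bar>"
      by (auto simp: eventually_at_filter power2_eq_square max_def)
    show "((\<lambda>h::real. \<bar>h\<bar>) \<longlongrightarrow> 0) (at 0)"
      by (rule tendsto_rabs_zero) (rule tendsto_ident_at)
  qed
  then show ?thesis using True by (simp add: DERIV_def)
qed

lemma product_test_function:
  fixes \<eta> \<eta>' \<phi> \<phi>' :: "real \<Rightarrow> real"
  assumes \<eta>: "\<And>t. (\<eta> has_real_derivative \<eta>' t) (at t)" "continuous_on UNIV \<eta>'"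
      "\<And>t. t \<notin> {a..b} \<Longrightarrow> \<eta> t = 0" "0 < a" "b < T"
    and \<phi>: "\<And>x. (\<phi> has_real_derivative \<phi>' x) (at x)" "continuous_on UNIV \<phi>'"
      "\<And>x. x \<notin> {1..X} \<Longrightarrow> \<phi> x = 0"
  shows "(\<lambda>z. \<eta> (fst z) * \<phi> (snd z)) \<in> C1c (strip 0 T)"
    and "dt (\<lambda>z. \<eta> (fst z) * \<phi> (snd z)) = (\<lambda>(t, x). \<eta>' t * \<phi> x)"
    and "dx (\<lambda>z. \<eta> (fst z) * \<phi> (snd z)) = (\<lambda>(t, x). \<eta> t * \<phi>' x)"
proof -
  have c: "continuous_on UNIV \<eta>" "continuous_on UNIV \<phi>"
    using \<eta>(1) \<phi>(1) by (auto intro!: continuous_at_imp_continuous_on DERIV_isCont)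
  show dt: "dt (\<lambda>z. \<eta> (fst z) * \<phi> (snd z)) = (\<lambda>(t, x). \<eta>' t * \<phi> x)"
    by (auto simp: dt_def fun_eq_iff intro!: DERIV_imp_deriv DERIV_cmult_right \<eta>)
  show dx: "dx (\<lambda>z. \<eta> (fst z) * \<phi> (snd z)) = (\<lambda>(t, x). \<eta> t * \<phi>' x)"
    by (auto simp: dx_def fun_eq_iff intro!: DERIV_imp_deriv DERIV_cmult \<phi>)
  have d: "(\<lambda>z. \<eta> (fst z) * \<phi> (snd z)) differentiable (at z)" for z :: "real \<times> real"
  proof (rule differentiable_mult)
    have "\<eta> differentiable (at (fst z))" "\<phi> differentiable (at (snd z))"
      using \<eta>(1) \<phi>(1) by (auto simp: real_differentiable_def)
    moreover have "fst differentiable (at z)" "snd differentiable (at z)"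
      by (auto intro: bounded_linear_imp_differentiable bounded_linear_fst bounded_linear_snd)
    ultimately show "(\<lambda>z. \<eta> (fst z)) differentiable (at z)" "(\<lambda>z. \<phi> (snd z)) differentiable (at z)"
      using differentiable_chain_at[of fst z \<eta>] differentiable_chain_at[of snd z \<phi>] by (auto simp: o_def)
  qed
  have c2: "continuous_on UNIV (\<lambda>z. \<eta>' (fst z) * \<phi> (snd z))" "continuous_on UNIV (\<lambda>z. \<eta> (fst z) * \<phi>' (snd z))"
    by (intro continuous_intros continuous_on_compose2[OF c(1)] continuous_on_compose2[OF c(2)]
        continuous_on_compose2[OF \<eta>(2)] continuous_on_compose2[OF \<phi>(2)]; simp)+
  show "(\<lambda>z. \<eta> (fst z) * \<phi> (snd z)) \<in> C1c (strip 0 T)"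
    unfolding C1c_def dt dx mem_Collect_eq
  proof (intro conjI allI exI[of _ "{a..b} \<times> {1..X}"] impI)
    show "{a..b} \<times> {1..X} \<subseteq> strip 0 T"
      using \<eta>(4,5) by auto
    show "\<eta> (fst z) * \<phi> (snd z) = 0" if "z \<notin> {a..b} \<times> {1..X}" for z
      using that \<eta>(3)[of "fst z"] \<phi>(3)[of "snd z"] by (cases z) auto
  qed (use d c2 in \<open>auto simp: case_prod_beta' intro: compact_Times\<close>)
qed

section \<open>Solutions with a continuous moment of order \<open>q\<close>\<close>

text \<open>The order \<open>q\<close> is left free, since the argument climbs from it to
  arbitrarily high orders in steps of \<gamma>.\<close>

locale moment_solution =
  fixes \<gamma> \<theta> T q :: real and w :: "real \<Rightarrow> real measure"
  assumes weak: "weak_solution \<gamma> \<theta> 0 T w"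
    and cont: "continuous_in_moment_space q {0..<T} w"
begin

lemma sets_w: "t \<in> {0<..<T} \<Longrightarrow> sets (w t) = sets halfline"
  using weak by (auto simp: weak_solution_def measure_curve_def)

lemma space_w: "t \<in> {0<..<T} \<Longrightarrow> space (w t) = {0<..}"
  by (rule space_eq_halfline[OF sets_w])

lemma measurable_w: "t \<in> {0<..<T} \<Longrightarrow> f \<in> borel_measurable borel \<Longrightarrow> f \<in> borel_measurable (w t)"
  by (rule borel_measurable_halfline[OF sets_w])

lemma emeasure_w_measurable:
  "A \<in> sets halfline \<Longrightarrow> (\<lambda>t. emeasure (w t) A) \<in> borel_measurable (restrict_space borel {0<..<T})"
  using weak by (auto simp: weak_solution_def measure_curve_def)

lemma nn_moment_w: "t \<in> {0<..<T} \<Longrightarrow> (\<integral>\<^sup>+x. ennreal (x powr q) \<partial>w t) < \<infinity>"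
  using cont by (auto simp: continuous_in_moment_space_def moment_space_def)

lemma integrable_powr_w: "t \<in> {0<..<T} \<Longrightarrow> integrable (w t) (\<lambda>x. x powr q)"
  using nn_moment_w by (intro integrableI_nonneg measurable_w) auto

lemma continuous_moment_w: "continuous_on {0<..<T} (\<lambda>t. LINT x|w t. x powr q)"
proof -
  have "continuous_on {0..<T} (\<lambda>t. LINT x|w t. x powr q * 1)"
    using cont unfolding continuous_in_moment_space_def
    by (elim conjE allE[of _ "\<lambda>x. 1"]) (auto simp: image_constant_conv)
  then show ?thesis by (auto intro: continuous_on_subset)
qed

lemma
  assumes "g \<in> borel_measurable borel" "\<And>x. x > 0 \<Longrightarrow> \<bar>g x\<bar> \<le> G * x powr q" "t \<in> {0<..<T}"
  shows integrable_dominated: "integrable (w t) g"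
    and integral_dominated: "\<bar>LINT x|w t. g x\<bar> \<le> G * (LINT x|w t. x powr q)"
proof -
  have i: "integrable (w t) (\<lambda>x. G * x powr q)"
    using integrable_powr_w[OF assms(3)] by simp
  show g: "integrable (w t) g"
    by (rule Bochner_Integration.integrable_bound[OF i measurable_w[OF assms(3,1)]])
      (auto simp: space_w[OF assms(3)] intro!: AE_I2 order_trans[OF assms(2)])
  have "\<bar>LINT x|w t. g x\<bar> \<le> (LINT x|w t. \<bar>g x\<bar>)"
    by (rule integral_abs_bound)
  also have "\<dots> \<le> (LINT x|w t. G * x powr q)"
    using g i assms(2) by (intro integral_mono) (auto simp: space_w[OF assms(3)])
  finally show "\<bar>LINT x|w t. g x\<bar> \<le> G * (LINT x|w t. x powr q)" by simp
qed

text \<open>On the compact time interval \<open>[a, b]\<close> inside \<open>(0, T)\<close> the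
  continuous moment of order \<open>q\<close> is bounded, and so is \<kappa>; a constant on
  \<open>[a, b]\<close> therefore dominates the product.\<close>

lemma time_integrable:
  assumes g: "g \<in> borel_measurable borel" "\<And>x. x > 0 \<Longrightarrow> \<bar>g x\<bar> \<le> G * x powr q" "G \<ge> 0"
    and \<kappa>: "continuous_on UNIV \<kappa>" "\<And>t. t \<notin> {a..b} \<Longrightarrow> \<kappa> t = 0" and ab: "0 < a" "b < T"
  shows "set_integrable lborel {0<..<T} (\<lambda>t. \<kappa> t * (LINT x|w t. g x))"
proof -
  have "bounded ((\<lambda>t. LINT x|w t. x powr q) ` {a..b})"
    using ab by (intro compact_imp_bounded compact_continuous_image
        continuous_on_subset[OF continuous_moment_w]) auto
  then obtain B where B: "\<And>t. t \<in> {a..b} \<Longrightarrow> (LINT x|w t. x powr q) \<le> B"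
    by (force simp: bounded_iff)
  have "bounded (\<kappa> ` {a..b})"
    using \<kappa>(1) by (intro compact_imp_bounded compact_continuous_image) (auto intro: continuous_on_subset)
  then obtain K where K: "\<And>t. t \<in> {a..b} \<Longrightarrow> \<bar>\<kappa> t\<bar> \<le> K"
    by (force simp: bounded_iff)
  have "(\<lambda>t. LINT x|w t. g x) \<in> borel_measurable (restrict_space borel {0<..<T})"
    using integrable_dominated[OF g(1,2)] measurable_restrict_space1[of g lborel borel]
    by (intro integral_measurable_family[where M = halfline] sets_w emeasure_w_measurable)
      (auto simp: space_restrict_space g(1))
  then have [measurable]: "(\<lambda>t. indicator {0<..<T} t *\<^sub>R (LINT x|w t. g x)) \<in> borel_measurable borel"
    by (subst (asm) borel_measurable_restrict_space_iff) auto
  have [measurable]: "\<kappa> \<in> borel_measurable borel"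
    using \<kappa>(1) by (rule borel_measurable_continuous_onI)
  have "integrable lborel (\<lambda>t. K * (G * B) * indicator {a..b} t)"
    by (intro integrable_mult_right integrable_real_indicator) (auto simp: emeasure_lborel_Icc_eq)
  then show ?thesis
    unfolding set_integrable_def
  proof (rule Bochner_Integration.integrable_bound)
    have "(\<lambda>t. \<kappa> t * (indicator {0<..<T} t *\<^sub>R (LINT x|w t. g x))) \<in> borel_measurable lborel"
      by measurable
    then show "(\<lambda>t. indicator {0<..<T} t *\<^sub>R (\<kappa> t * (LINT x|w t. g x))) \<in> borel_measurable lborel"
      by (simp add: mult_ac)
    show "AE t in lborel. norm (indicator {0<..<T} t *\<^sub>R (\<kappa> t * (LINT x|w t. g x)))
        \<le> norm (K * (G * B) * indicator {a..b} t)"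
    proof (rule AE_I2)
      fix t
      show "norm (indicator {0<..<T} t *\<^sub>R (\<kappa> t * (LINT x|w t. g x)))
        \<le> norm (K * (G * B) * indicator {a..b} t)"
      proof (cases "t \<in> {a..b}")
        case True
        then have t: "t \<in> {0<..<T}" using ab by auto
        have "\<bar>LINT x|w t. g x\<bar> \<le> G * B"
          using integral_dominated[OF g(1,2) t] mult_left_mono[OF B[OF True] g(3)] by linarith
        then have "\<bar>\<kappa> t\<bar> * \<bar>LINT x|w t. g x\<bar> \<le> K * (G * B)"
          using K[OF True] by (intro mult_mono) auto
        from order_trans[OF this abs_ge_self] show ?thesis using t True by (simp add: abs_mult)
      qed (use \<kappa>(2) in simp)
    qed
  qed
qed

text \<open>Testing with \<open>\<eta> t * \<phi> x\<close> equates the time integral of \<eta>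
  times the pairing of \<open>w\<close> with the transformed \<phi> to minus that of
  \<open>\<eta>'\<close> times the pairing with \<phi>. The transformed \<phi> keeps a nonlocal tail
  at infinity, so it is replaced by a minorant \<open>h\<close> that the moment of order
  \<open>q\<close> controls.\<close>

lemma tested_inequality:
  fixes \<eta> \<eta>' \<phi> \<phi>' h :: "real \<Rightarrow> real"
  assumes \<theta>: "\<theta> > 0"
    and \<eta>: "\<And>t. (\<eta> has_real_derivative \<eta>' t) (at t)" "continuous_on UNIV \<eta>'"
      "\<And>t. t \<notin> {a..b} \<Longrightarrow> \<eta> t = 0" "\<And>t. \<eta> t \<ge> 0" and ab: "0 < a" "b < T"
    and \<phi>: "\<And>x. (\<phi> has_real_derivative \<phi>' x) (at x)" "continuous_on UNIV \<phi>'"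
      "\<And>x. x \<notin> {1..X} \<Longrightarrow> \<phi> x = 0" "\<And>x. \<phi> x \<ge> 0"
    and h: "h \<in> borel_measurable borel" "\<And>x. x > 0 \<Longrightarrow> \<bar>h x\<bar> \<le> G * x powr q" "G \<ge> 0"
    and low: "\<And>y. y > 0 \<Longrightarrow> h y \<le> y powr (\<gamma> + 1) * \<phi>' y - y powr \<gamma> * \<phi> y
        + \<theta> * (y powr (\<gamma> - 1) * (LBINT x:{0<..<y}. \<phi> x))"
  shows "set_integrable lborel {0<..<T} (\<lambda>t. \<eta> t * (LINT x|w t. h x))"
    and "\<And>t. t \<in> {0<..<T} \<Longrightarrow> integrable (w t) \<phi>"
    and "set_integrable lborel {0<..<T} (\<lambda>t. \<eta>' t * (LINT x|w t. \<phi> x))"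
    and "(LBINT t:{0<..<T}. \<eta> t * (LINT x|w t. h x)) \<le> - (LBINT t:{0<..<T}. \<eta>' t * (LINT x|w t. \<phi> x))"
proof -
  have \<eta>c: "continuous_on UNIV \<eta>" and \<phi>c: "continuous_on UNIV \<phi>"
    using \<eta>(1) \<phi>(1) by (auto intro!: continuous_at_imp_continuous_on DERIV_isCont)
  have zero: "f' z = 0" if "\<And>z. (f has_real_derivative f' z) (at z)" "\<And>z. f z \<ge> 0" "f z = 0"
    for f f' :: "real \<Rightarrow> real" and z
    using DERIV_local_min[OF that(1), of 1 z] that(2,3) by auto
  have \<eta>'0: "\<eta>' t = 0" if "t \<notin> {a..b}" for t using zero[OF \<eta>(1,4) \<eta>(3)[OF that]] .
  have \<phi>'0: "\<phi>' x = 0" if "x \<notin> {1..X}" for x using zero[OF \<phi>(1,4) \<phi>(3)[OF that]] .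
  define l where "l x = x powr (\<gamma> + 1) * \<phi>' x - x powr \<gamma> * \<phi> x" for x
  have [measurable]: "\<phi> \<in> borel_measurable borel" "\<phi>' \<in> borel_measurable borel"
    using \<phi>c \<phi>(2) by (auto intro: borel_measurable_continuous_onI)
  have l: "l \<in> borel_measurable borel" unfolding l_def by measurable
  obtain Gl where Gl: "Gl \<ge> 0" "\<And>x. x > 0 \<Longrightarrow> \<bar>l x\<bar> \<le> Gl * x powr q"
  proof (rule dominated_by_powr[of l X q])
    show "continuous_on {0<..} l" unfolding l_def
      by (intro continuous_intros continuous_on_subset[OF \<phi>c] continuous_on_subset[OF \<phi>(2)]) auto
  qed (use \<phi>(3) \<phi>'0 in \<open>auto simp: l_def\<close>)
  obtain Gf where Gf: "Gf \<ge> 0" "\<And>x. x > 0 \<Longrightarrow> \<bar>\<phi> x\<bar> \<le> Gf * x powr q"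
    by (rule dominated_by_powr[of \<phi> X q]) (use \<phi>(3) continuous_on_subset[OF \<phi>c] in auto)
  show ih: "set_integrable lborel {0<..<T} (\<lambda>t. \<eta> t * (LINT x|w t. h x))"
    by (rule time_integrable[OF h \<eta>c \<eta>(3) ab])
  have il: "set_integrable lborel {0<..<T} (\<lambda>t. \<eta> t * (LINT x|w t. l x))"
    by (rule time_integrable[OF l Gl(2,1) \<eta>c \<eta>(3) ab])
  show i\<phi>: "set_integrable lborel {0<..<T} (\<lambda>t. \<eta>' t * (LINT x|w t. \<phi> x))"
    by (rule time_integrable[OF _ Gf(2,1) \<eta>(2) \<eta>'0 ab]) auto
  show \<phi>w: "integrable (w t) \<phi>" if "t \<in> {0<..<T}" for t
    by (rule integrable_dominated[OF _ Gf(2) that]) auto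
  have lw: "integrable (w t) l" if "t \<in> {0<..<T}" for t
    by (rule integrable_dominated[OF l Gl(2) that])
  have hw: "integrable (w t) h" if "t \<in> {0<..<T}" for t
    by (rule integrable_dominated[OF h(1,2) that])
  define \<Phi> where "\<Phi> y = (LBINT x:{0<..<y}. \<phi> x)" for y
  \<comment> \<open>\<open>\<Phi>\<close> need not vanish for large \<open>y\<close>. The
    integrability of this nonlocal term comes from the definition of weak solution, and only for
    almost every \<open>t\<close>, so the comparison with \<open>h\<close> below is made almost
    everywhere in time.\<close>
  define R where "R t = (LINT y|w t. y powr (\<gamma> - 1) * (\<eta> t * \<Phi> y))" for t
  let ?\<psi> = "\<lambda>z. \<eta> (fst z) * \<phi> (snd z)"
  have test: "?\<psi> \<in> C1c (strip 0 T)" "dt ?\<psi> = (\<lambda>(t, x). \<eta>' t * \<phi> x)" "dx ?\<psi> = (\<lambda>(t, x). \<eta> t * \<phi>' x)"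
    using product_test_function[of \<eta> \<eta>' a b T \<phi> \<phi>' X] \<eta>(1-3) ab \<phi>(1-3) by simp_all
  have "(AE t in lborel. t \<in> {0<..<T} \<longrightarrow>
           integrable (w t) (\<lambda>y. y powr (\<gamma> - 1) * (LBINT x:{0<..<y}. ?\<psi> (t, x)))) \<and>
        set_integrable lborel {0<..<T}
          (\<lambda>t. LINT y|w t. y powr (\<gamma> - 1) * (LBINT x:{0<..<y}. ?\<psi> (t, x))) \<and>
        (LBINT t:{0<..<T}. (LINT x|w t.
           dt ?\<psi> (t, x) + x powr (\<gamma> + 1) * dx ?\<psi> (t, x) - x powr \<gamma> * ?\<psi> (t, x)))
        = - \<theta> * (LBINT t:{0<..<T}. (LINT y|w t.
           y powr (\<gamma> - 1) * (LBINT x:{0<..<y}. ?\<psi> (t, x))))"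
    by (rule bspec[OF conjunct2[OF weak[unfolded weak_solution_def]] test(1)])
  then have W: "AE t in lborel. t \<in> {0<..<T} \<longrightarrow> integrable (w t) (\<lambda>y. y powr (\<gamma> - 1) * (\<eta> t * \<Phi> y))"
      "set_integrable lborel {0<..<T} R"
      "(LBINT t:{0<..<T}. (LINT x|w t. \<eta>' t * \<phi> x + x powr (\<gamma> + 1) * (\<eta> t * \<phi>' x) - x powr \<gamma> * (\<eta> t * \<phi> x)))
        = - \<theta> * (LBINT t:{0<..<T}. R t)"
    by (simp_all add: test(2,3) \<Phi>_def[symmetric] R_def[abs_def])
  have "(LBINT t:{0<..<T}. (LINT x|w t. \<eta>' t * \<phi> x + x powr (\<gamma> + 1) * (\<eta> t * \<phi>' x) - x powr \<gamma> * (\<eta> t * \<phi> x)))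
      = (LBINT t:{0<..<T}. \<eta>' t * (LINT x|w t. \<phi> x) + \<eta> t * (LINT x|w t. l x))"
  proof (intro set_lebesgue_integral_cong allI impI)
    fix t assume t: "t \<in> {0<..<T}"
    have "(LINT x|w t. \<eta>' t * \<phi> x + x powr (\<gamma> + 1) * (\<eta> t * \<phi>' x) - x powr \<gamma> * (\<eta> t * \<phi> x))
        = (LINT x|w t. \<eta>' t * \<phi> x + \<eta> t * l x)"
      by (simp add: l_def algebra_simps)
    then show "(LINT x|w t. \<eta>' t * \<phi> x + x powr (\<gamma> + 1) * (\<eta> t * \<phi>' x) - x powr \<gamma> * (\<eta> t * \<phi> x))
        = \<eta>' t * (LINT x|w t. \<phi> x) + \<eta> t * (LINT x|w t. l x)"
      using \<phi>w[OF t] lw[OF t] by simp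
  qed simp
  also have "\<dots> = (LBINT t:{0<..<T}. \<eta>' t * (LINT x|w t. \<phi> x)) + (LBINT t:{0<..<T}. \<eta> t * (LINT x|w t. l x))"
    by (rule set_integral_add[OF i\<phi> il])
  finally have eq: "(LBINT t:{0<..<T}. \<eta>' t * (LINT x|w t. \<phi> x)) + (LBINT t:{0<..<T}. \<eta> t * (LINT x|w t. l x))
      = - \<theta> * (LBINT t:{0<..<T}. R t)"
    using W(3) by simp
  have iR: "set_integrable lborel {0<..<T} (\<lambda>t. \<theta> * R t)"
    using W(2) by simp
  have "(LBINT t:{0<..<T}. \<eta> t * (LINT x|w t. h x))
      \<le> (LBINT t:{0<..<T}. \<eta> t * (LINT x|w t. l x) + \<theta> * R t)"
  proof (rule set_integral_mono_AE[OF ih set_integral_add(1)[OF il iR]])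
    show "AE t\<in>{0<..<T} in lborel. \<eta> t * (LINT x|w t. h x) \<le> \<eta> t * (LINT x|w t. l x) + \<theta> * R t"
      using W(1)
    proof eventually_elim
      case (elim t)
      show ?case
      proof (intro impI)
        assume t: "t \<in> {0<..<T}"
        then have i: "integrable (w t) (\<lambda>y. y powr (\<gamma> - 1) * (\<eta> t * \<Phi> y))" using elim by simp
        have "(LINT x|w t. \<eta> t * h x) \<le> (LINT x|w t. \<eta> t * l x + \<theta> * (x powr (\<gamma> - 1) * (\<eta> t * \<Phi> x)))"
        proof (rule integral_mono)
          show "\<eta> t * h y \<le> \<eta> t * l y + \<theta> * (y powr (\<gamma> - 1) * (\<eta> t * \<Phi> y))" if "y \<in> space (w t)" for y
          proof -
            have "y > 0" using that space_w[OF t] by simp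
            from mult_left_mono[OF low[OF this] \<eta>(4)[of t]] show ?thesis
              by (simp add: l_def \<Phi>_def algebra_simps)
          qed
        qed (use hw[OF t] lw[OF t] i in simp_all)
        also have "\<dots> = \<eta> t * (LINT x|w t. l x) + \<theta> * R t"
          using lw[OF t] i by (simp add: R_def)
        finally show "\<eta> t * (LINT x|w t. h x) \<le> \<eta> t * (LINT x|w t. l x) + \<theta> * R t"
          by simp
      qed
    qed
  qed
  also have "\<dots> = (LBINT t:{0<..<T}. \<eta> t * (LINT x|w t. l x)) + \<theta> * (LBINT t:{0<..<T}. R t)"
    by (simp add: set_integral_add(2)[OF il iR])
  also have "\<dots> = - (LBINT t:{0<..<T}. \<eta>' t * (LINT x|w t. \<phi> x))"
    using eq by simp
  finally show "(LBINT t:{0<..<T}. \<eta> t * (LINT x|w t. h x)) \<le> - (LBINT t:{0<..<T}. \<eta>' t * (LINT x|w t. \<phi> x))" .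
qed

lemma nn_integral_w_measurable:
  fixes f :: "real \<Rightarrow> ennreal"
  assumes f: "f \<in> borel_measurable borel" and A: "A \<in> sets borel" "A \<subseteq> {0<..<T}"
  shows "(\<lambda>t. (\<integral>\<^sup>+x. f x \<partial>w t) * indicator A t) \<in> borel_measurable borel"
proof -
  have "(\<lambda>t. \<integral>\<^sup>+x. f x \<partial>w t) \<in> borel_measurable (restrict_space borel {0<..<T})"
    using measurable_restrict_space1[of f lborel borel "{0<..}"] f
    by (intro nn_integral_measurable_family[where M = halfline] sets_w emeasure_w_measurable)
      (auto simp: space_restrict_space)
  then have [measurable]: "(\<lambda>t. (\<integral>\<^sup>+x. f x \<partial>w t) * indicator {0<..<T} t) \<in> borel_measurable borel"
    by (subst (asm) borel_measurable_restrict_space_iff_ennreal) auto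
  have "(\<lambda>t. (\<integral>\<^sup>+x. f x \<partial>w t) * indicator {0<..<T} t * indicator A t) \<in> borel_measurable borel"
    using A(1) by measurable
  moreover have "(\<integral>\<^sup>+x. f x \<partial>w t) * indicator {0<..<T} t * indicator A t = (\<integral>\<^sup>+x. f x \<partial>w t) * indicator A t" for t
    using A(2) by (auto simp: indicator_def)
  ultimately show ?thesis by simp
qed

section \<open>Bootstrapping the moments\<close>

text \<open>Test functions of size \<open>x powr p\<close> produce a non-negative lower bound of
  order \<open>p + \<gamma>\<close>. The time derivative falls on the cut-off, at the price of
  shrinking \<open>[a, b]\<close> to \<open>[t1, t2]\<close>. The bound does not depend on the
  spatial cut-off, which monotone convergence then removes.\<close>

lemma moment_gain:
  assumes \<theta>: "\<theta> > 1" and t: "0 < a" "a < t1" "t1 \<le> t2" "t2 < b" "b < T"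
    and fin: "(\<integral>\<^sup>+t\<in>{a..b}. (\<integral>\<^sup>+x\<in>{1<..}. ennreal (x powr p) \<partial>w t) \<partial>lborel) < \<infinity>"
  shows "(\<integral>\<^sup>+t\<in>{t1..t2}. (\<integral>\<^sup>+x\<in>{1<..}. ennreal (x powr (p + \<gamma>)) \<partial>w t) \<partial>lborel) < \<infinity>"
proof -
  have tT: "s \<in> {0<..<T}" if "s \<in> {a..b}" for s using that t by auto
  define Y where "Y s = (s - a) * (b - s)" for s
  define \<eta> where "\<eta> s = (max 0 (Y s))\<^sup>2" for s
  define \<eta>' where "\<eta>' s = 2 * max 0 (Y s) * (a + b - 2 * s)" for s
  have Y0: "Y s \<le> 0" if "s \<notin> {a..b}" for s
  proof (cases "s < a")
    case True
    then have "b - s \<ge> 0" using t by linarith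
    then show ?thesis unfolding Y_def using True by (intro mult_nonpos_nonneg) auto
  next
    case False
    then show ?thesis unfolding Y_def using that by (intro mult_nonneg_nonpos) auto
  qed
  have D\<eta>: "(\<eta> has_real_derivative \<eta>' s) (at s)" for s
  proof -
    have "(Y has_real_derivative (a + b - 2 * s)) (at s)"
      unfolding Y_def by (auto intro!: derivative_eq_intros)
    from DERIV_chain2[of "\<lambda>y. (max 0 y)\<^sup>2" "2 * max 0 (Y s)" Y s, OF square_pos_part_derivative this]
    show ?thesis unfolding \<eta>_def \<eta>'_def by simp
  qed
  have c\<eta>': "continuous_on S \<eta>'" for S
    unfolding \<eta>'_def Y_def by (intro continuous_intros)
  have "bounded (\<eta>' ` {a..b})"
    by (intro compact_imp_bounded compact_continuous_image c\<eta>') auto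
  then obtain D where D: "D > 0" "\<And>s. s \<in> {a..b} \<Longrightarrow> \<bar>\<eta>' s\<bar> \<le> D"
    by (auto simp: bounded_pos)
  \<comment> \<open>The factors \<open>s - a\<close> and \<open>b - s\<close> are smallest at
    opposite ends of \<open>[t1, t2]\<close>; the product of these minima bounds \<open>Y\<close>
    from below there.\<close>
  define m where "m = ((t1 - a) * (b - t2))\<^sup>2"
  have m: "m > 0" unfolding m_def using t by simp
  have \<eta>m: "\<eta> s \<ge> m" if "s \<in> {t1..t2}" for s
  proof -
    have "(t1 - a) * (b - t2) \<le> Y s" "0 \<le> (t1 - a) * (b - t2)"
      unfolding Y_def using that t by (auto intro!: mult_mono)
    then show ?thesis unfolding m_def \<eta>_def by (intro power_mono) auto
  qed
  obtain \<omega> C where \<omega>: "\<omega> > 0" and C: "C \<ge> 0"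
    and test: "\<And>\<mu> N. continuous_on UNIV \<mu> \<Longrightarrow> (\<And>z. 0 \<le> \<mu> z) \<Longrightarrow> (\<And>z. \<mu> z \<le> exp (p * z)) \<Longrightarrow>
      (\<And>z. z \<le> 0 \<Longrightarrow> \<mu> z = 0) \<Longrightarrow> (\<And>z. z \<ge> N \<Longrightarrow> \<mu> z = 0) \<Longrightarrow>
      \<exists>\<phi> \<phi>' X. (\<forall>x. (\<phi> has_real_derivative \<phi>' x) (at x)) \<and> continuous_on UNIV \<phi>' \<and>
        (\<forall>x. x \<notin> {1<..X} \<longrightarrow> \<phi> x = 0) \<and> (\<forall>x. 0 \<le> \<phi> x) \<and> (\<forall>x>0. \<phi> x \<le> C * x powr p) \<and>
        (\<forall>y>0. \<omega> * (y powr \<gamma> * \<mu> (ln y)) \<le>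
           y powr (\<gamma> + 1) * \<phi>' y - y powr \<gamma> * \<phi> y + \<theta> * (y powr (\<gamma> - 1) * (LBINT x:{0<..<y}. \<phi> x)))"
    using cutoff_test_function[OF \<theta>, of p \<gamma>] by blast
  \<comment> \<open>Continuous trapezoids supported in \<open>[0, n]\<close>, equal to 1 on
    \<open>[1/n, n - 1]\<close> for \<open>n \<ge> 2\<close>, increasing with \<open>n\<close> to
    the indicator of the positive half-line.\<close>
  define \<xi> where "\<xi> n z = max 0 (min 1 (min (real n * z) (real n - z)))" for n z
  define \<mu> where "\<mu> n z = exp (p * z) * \<xi> n z" for n z
  have \<xi>: "0 \<le> \<xi> n z" "\<xi> n z \<le> 1" "z \<le> 0 \<Longrightarrow> \<xi> n z = 0" "z \<ge> real n \<Longrightarrow> \<xi> n z = 0" for n z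
    using mult_nonneg_nonpos[of "real n" z]
    by (auto simp: \<xi>_def min_le_iff_disj intro!: max_absorb1)
  have \<xi>_mono: "\<xi> n z \<le> \<xi> n' z" if "n \<le> n'" for n n' z
  proof (cases "z \<le> 0")
    case False
    then have "real n * z \<le> real n' * z" using that by (intro mult_right_mono) auto
    then show ?thesis using that unfolding \<xi>_def by (intro max.mono min.mono) auto
  qed (simp add: \<xi>)
  have \<mu>: "continuous_on S (\<mu> n)" "0 \<le> \<mu> n z" "\<mu> n z \<le> exp (p * z)" "z \<le> 0 \<Longrightarrow> \<mu> n z = 0"
      "z \<ge> real n \<Longrightarrow> \<mu> n z = 0" for n z S
    using \<xi>(2)[of n z]
    by (auto simp: \<mu>_def \<xi> mult_left_le) (auto simp: \<mu>_def[abs_def] \<xi>_def intro!: continuous_intros)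
  define k where "k n x = x powr \<gamma> * \<mu> n (ln x)" for n x
  have k0: "k n x \<ge> 0" for n x using \<mu>(2) by (simp add: k_def)
  have [measurable]: "\<mu> n \<in> borel_measurable borel" for n
    by (intro borel_measurable_continuous_onI \<mu>)
  have k_meas [measurable]: "k n \<in> borel_measurable borel" for n
    unfolding k_def by measurable
  define F where "F n s = (\<integral>\<^sup>+x. ennreal (k n x) \<partial>w s)" for n s
  define I where "I = (\<integral>\<^sup>+t\<in>{a..b}. (\<integral>\<^sup>+x\<in>{1<..}. ennreal (x powr p) \<partial>w t) \<partial>lborel)"
  have F_meas [measurable]: "(\<lambda>s. F n s * indicator {t1..t2} s) \<in> borel_measurable borel" for n
    unfolding F_def using t by (intro nn_integral_w_measurable) auto
  have M_meas [measurable]: "(\<lambda>s. (\<integral>\<^sup>+x\<in>{1<..}. ennreal (x powr p) \<partial>w s) * indicator {a..b} s) \<in> borel_measurable borel"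
    using t by (intro nn_integral_w_measurable) auto
  \<comment> \<open>The right-hand side is free of \<open>n\<close>: \<open>D\<close> bounds the
    derivative of \<eta>, and \<open>C\<close> bounds every \<phi> by \<open>x powr p\<close> on its
    support in \<open>(1, X]\<close>.\<close>
  have bound: "ennreal (m * \<omega>) * (\<integral>\<^sup>+s\<in>{t1..t2}. F n s \<partial>lborel) \<le> ennreal (D * C) * I" for n
  proof -
    obtain \<phi> \<phi>' X where \<phi>: "\<And>x. (\<phi> has_real_derivative \<phi>' x) (at x)" "continuous_on UNIV \<phi>'"
      "\<And>x. x \<notin> {1<..X} \<Longrightarrow> \<phi> x = 0" "\<And>x. 0 \<le> \<phi> x" "\<And>x. x > 0 \<Longrightarrow> \<phi> x \<le> C * x powr p"
      "\<And>y. y > 0 \<Longrightarrow> \<omega> * k n y \<le> y powr (\<gamma> + 1) * \<phi>' y - y powr \<gamma> * \<phi> y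
         + \<theta> * (y powr (\<gamma> - 1) * (LBINT x:{0<..<y}. \<phi> x))"
      unfolding k_def using test[of "\<mu> n" "real n"] \<mu> by metis
    obtain G where G: "G \<ge> 0" "\<And>x. x > 0 \<Longrightarrow> \<bar>k n x\<bar> \<le> G * x powr q"
    proof (rule dominated_by_powr[of "k n" "exp (real n)" q])
      show "continuous_on {0<..} (k n)" unfolding k_def
        by (intro continuous_intros continuous_on_compose2[OF \<mu>(1)[of UNIV n]]) auto
      show "k n x = 0" if "x > 0" "x \<notin> {1..exp (real n)}" for x
      proof (cases "x < 1")
        case True
        then show ?thesis using \<mu>(4)[of "ln x" n] that by (simp add: k_def)
      next
        case False
        then have "x > exp (real n)" using that by auto
        then have "ln x \<ge> real n" using that by (metis exp_le_cancel_iff exp_ln less_imp_le)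
        then show ?thesis using \<mu>(5) by (simp add: k_def)
      qed
    qed blast
    have kw: "integrable (w s) (k n)" if "s \<in> {0<..<T}" for s
      by (rule integrable_dominated[OF k_meas G(2) that])
    have Fk: "F n s = ennreal (LINT x|w s. k n x)" if "s \<in> {0<..<T}" for s
      unfolding F_def using kw[OF that] k0 by (intro nn_integral_eq_integral) auto
    have "set_integrable lborel {0<..<T} (\<lambda>s. \<eta> s * (LINT x|w s. \<omega> * k n x)) \<and>
      (\<forall>s\<in>{0<..<T}. integrable (w s) \<phi>) \<and>
      set_integrable lborel {0<..<T} (\<lambda>s. \<eta>' s * (LINT x|w s. \<phi> x)) \<and>
      (LBINT s:{0<..<T}. \<eta> s * (LINT x|w s. \<omega> * k n x)) \<le> - (LBINT s:{0<..<T}. \<eta>' s * (LINT x|w s. \<phi> x))"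
    proof (intro conjI ballI)
      have \<eta>0: "\<eta> s = 0" if "s \<notin> {a..b}" for s using Y0[OF that] by (simp add: \<eta>_def)
      have \<eta>p: "\<eta> s \<ge> 0" for s by (simp add: \<eta>_def)
      have \<phi>0: "\<phi> x = 0" if "x \<notin> {1..X}" for x using \<phi>(3)[of x] that by auto
      have h: "(\<lambda>x. \<omega> * k n x) \<in> borel_measurable borel" by measurable
      have hG: "\<bar>\<omega> * k n x\<bar> \<le> \<omega> * G * x powr q" if "x > 0" for x
        using mult_left_mono[OF G(2)[OF that], of \<omega>] \<omega> by (simp add: abs_mult)
      have \<theta>0: "\<theta> > 0" using \<theta> by simp
      have G0: "\<omega> * G \<ge> 0" using \<omega> G by simp
      note * = tested_inequality[of \<eta> \<eta>' a b \<phi> \<phi>' X "\<lambda>x. \<omega> * k n x" "\<omega> * G",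
          OF \<theta>0 D\<eta> c\<eta>' \<eta>0 \<eta>p t(1,5) \<phi>(1,2) \<phi>0 \<phi>(4) h hG G0 \<phi>(6)]
      show "set_integrable lborel {0<..<T} (\<lambda>s. \<eta> s * (LINT x|w s. \<omega> * k n x))"
        by (rule *(1))
      show "integrable (w s) \<phi>" if "s \<in> {0<..<T}" for s by (rule *(2)) (use that in simp_all)
      show "set_integrable lborel {0<..<T} (\<lambda>s. \<eta>' s * (LINT x|w s. \<phi> x))"
        by (rule *(3))
      show "(LBINT s:{0<..<T}. \<eta> s * (LINT x|w s. \<omega> * k n x)) \<le> - (LBINT s:{0<..<T}. \<eta>' s * (LINT x|w s. \<phi> x))"
        by (rule *(4))
    qed
    then have ik: "set_integrable lborel {0<..<T} (\<lambda>s. \<eta> s * (LINT x|w s. \<omega> * k n x))"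
      and i\<phi>: "\<And>s. s \<in> {0<..<T} \<Longrightarrow> integrable (w s) \<phi>"
      and i\<eta>: "set_integrable lborel {0<..<T} (\<lambda>s. \<eta>' s * (LINT x|w s. \<phi> x))"
      and ineq: "(LBINT s:{0<..<T}. \<eta> s * (LINT x|w s. \<omega> * k n x)) \<le> - (LBINT s:{0<..<T}. \<eta>' s * (LINT x|w s. \<phi> x))"
      by auto
    have "ennreal (m * \<omega>) * (\<integral>\<^sup>+s\<in>{t1..t2}. F n s \<partial>lborel)
        = (\<integral>\<^sup>+s. ennreal (m * \<omega>) * (F n s * indicator {t1..t2} s) \<partial>lborel)"
      by (rule nn_integral_cmult[symmetric]) simp
    also have "\<dots> \<le> (\<integral>\<^sup>+s. ennreal (indicator {0<..<T} s *\<^sub>R (\<eta> s * (LINT x|w s. \<omega> * k n x))) \<partial>lborel)"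
    proof (rule nn_integral_mono)
      fix s
      show "ennreal (m * \<omega>) * (F n s * indicator {t1..t2} s)
          \<le> ennreal (indicator {0<..<T} s *\<^sub>R (\<eta> s * (LINT x|w s. \<omega> * k n x)))"
      proof (cases "s \<in> {t1..t2}")
        case True
        then have s: "s \<in> {0<..<T}" using t by auto
        have "(LINT x|w s. k n x) \<ge> 0" using k0 by simp
        then have "m * \<omega> * (LINT x|w s. k n x) \<le> \<eta> s * (LINT x|w s. \<omega> * k n x)"
          using \<eta>m[OF True] \<omega> by (simp add: mult.assoc mult_right_mono)
        then show ?thesis
          using s True m \<omega> by (simp add: Fk ennreal_mult'[symmetric] ennreal_leI)
      qed simp
    qed
    also have "\<dots> = ennreal (LBINT s:{0<..<T}. \<eta> s * (LINT x|w s. \<omega> * k n x))"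
      unfolding set_lebesgue_integral_def using ik[unfolded set_integrable_def] k0 \<omega>
      by (intro nn_integral_eq_integral) (auto intro!: AE_I2 mult_nonneg_nonneg simp: \<eta>_def)
    also have "\<dots> \<le> ennreal (norm (LBINT s:{0<..<T}. \<eta>' s * (LINT x|w s. \<phi> x)))"
      using ineq by (intro ennreal_leI) simp
    also have "\<dots> \<le> (\<integral>\<^sup>+s. ennreal (norm (indicator {0<..<T} s *\<^sub>R (\<eta>' s * (LINT x|w s. \<phi> x)))) \<partial>lborel)"
      unfolding set_lebesgue_integral_def
      by (rule integral_norm_bound_ennreal[OF i\<eta>[unfolded set_integrable_def]])
    also have "\<dots> \<le> (\<integral>\<^sup>+s. ennreal (D * C) * ((\<integral>\<^sup>+x\<in>{1<..}. ennreal (x powr p) \<partial>w s) * indicator {a..b} s) \<partial>lborel)"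
    proof (rule nn_integral_mono)
      fix s
      show "ennreal (norm (indicator {0<..<T} s *\<^sub>R (\<eta>' s * (LINT x|w s. \<phi> x))))
          \<le> ennreal (D * C) * ((\<integral>\<^sup>+x\<in>{1<..}. ennreal (x powr p) \<partial>w s) * indicator {a..b} s)"
      proof (cases "s \<in> {a..b}")
        case True
        have s: "s \<in> {0<..<T}" by (rule tT[OF True])
        have "ennreal (LINT x|w s. \<phi> x) = (\<integral>\<^sup>+x. ennreal (\<phi> x) \<partial>w s)"
          using i\<phi>[OF s] \<phi>(4) by (intro nn_integral_eq_integral[symmetric]) auto
        also have "\<dots> \<le> (\<integral>\<^sup>+x. ennreal C * (ennreal (x powr p) * indicator {1<..} x) \<partial>w s)"
        proof (rule nn_integral_mono)
          fix x assume "x \<in> space (w s)"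
          then have "x > 0" using space_w[OF s] by simp
          then show "ennreal (\<phi> x) \<le> ennreal C * (ennreal (x powr p) * indicator {1<..} x)"
            using \<phi>(3)[of x] \<phi>(5)[of x] C by (cases "x > 1") (simp_all add: ennreal_mult'[symmetric] ennreal_leI)
        qed
        also have "\<dots> = ennreal C * (\<integral>\<^sup>+x\<in>{1<..}. ennreal (x powr p) \<partial>w s)"
          by (intro nn_integral_cmult measurable_w[OF s]) simp
        finally have "ennreal D * ennreal (LINT x|w s. \<phi> x)
            \<le> ennreal D * (ennreal C * (\<integral>\<^sup>+x\<in>{1<..}. ennreal (x powr p) \<partial>w s))"
          by (rule mult_left_mono) simp
        moreover have "ennreal (norm (\<eta>' s * (LINT x|w s. \<phi> x))) \<le> ennreal D * ennreal (LINT x|w s. \<phi> x)"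
        proof -
          have "\<bar>\<eta>' s\<bar> * (LINT x|w s. \<phi> x) \<le> D * (LINT x|w s. \<phi> x)"
            using D(2)[OF True] \<phi>(4) by (intro mult_right_mono) auto
          then show ?thesis
            using D(1) \<phi>(4) by (simp add: ennreal_mult'[symmetric] ennreal_leI abs_mult)
        qed
        ultimately show ?thesis
          using s True D(1) C by (simp add: ennreal_mult mult.assoc)
      next
        case False
        then show ?thesis using Y0[OF False] by (simp add: \<eta>'_def)
      qed
    qed
    also have "\<dots> = ennreal (D * C) * I"
      unfolding I_def by (rule nn_integral_cmult) simp
    finally show ?thesis .
  qed
  have incF: "incseq (\<lambda>n s. F n s * indicator {t1..t2} s)"
    unfolding F_def k_def \<mu>_def
    by (intro incseq_SucI le_funI mult_right_mono nn_integral_mono ennreal_leI mult_left_mono \<xi>_mono) auto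
  have supF: "(SUP n. F n s) = (\<integral>\<^sup>+x\<in>{1<..}. ennreal (x powr (p + \<gamma>)) \<partial>w s)" if s: "s \<in> {t1..t2}" for s
  proof -
    have s: "s \<in> {0<..<T}" using s t by auto
    have "incseq (\<lambda>n x. ennreal (k n x))"
      unfolding k_def \<mu>_def
      by (intro incseq_SucI le_funI ennreal_leI mult_left_mono \<xi>_mono) auto
    then have "(SUP n. F n s) = (\<integral>\<^sup>+x. (SUP n. ennreal (k n x)) \<partial>w s)"
      unfolding F_def by (intro nn_integral_monotone_convergence_SUP[symmetric] measurable_w[OF s]) auto
    also have "\<dots> = (\<integral>\<^sup>+x\<in>{1<..}. ennreal (x powr (p + \<gamma>)) \<partial>w s)"
    proof (rule nn_integral_cong)
      fix x assume "x \<in> space (w s)"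
      then have x: "x > 0" using space_w[OF s] by simp
      have ex: "x powr \<gamma> * exp (p * ln x) = x powr (p + \<gamma>)"
        using x by (simp add: powr_def exp_add[symmetric] algebra_simps)
      show "(SUP n. ennreal (k n x)) = ennreal (x powr (p + \<gamma>)) * indicator {1<..} x"
      proof (cases "x > 1")
        case True
        then have lx: "ln x > 0" by simp
        \<comment> \<open>This choice puts both slopes of the trapezoid above 1 at
          \<open>ln x\<close>, so the cut-off is inactive there.\<close>
        obtain n :: nat where n: "real n > max (1 / ln x) (1 + ln x)" using reals_Archimedean2 by blast
        then have "\<xi> n (ln x) = 1" using lx by (auto simp: \<xi>_def field_simps)
        then have "k n x = x powr (p + \<gamma>)" using ex by (simp add: k_def \<mu>_def)
        moreover have "k n x \<le> x powr (p + \<gamma>)" for n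
        proof -
          have "k n x \<le> x powr \<gamma> * exp (p * ln x)"
            unfolding k_def by (intro mult_left_mono \<mu>) auto
          then show ?thesis using ex by simp
        qed
        ultimately have "(SUP n. ennreal (k n x)) = ennreal (x powr (p + \<gamma>))"
          by (intro antisym SUP_least ennreal_leI) (auto intro: SUP_upper2[of n])
        then show ?thesis using True by simp
      next
        case False
        then have "ln x \<le> 0" using x by simp
        then show ?thesis using False \<mu>(4) by (simp add: k_def)
      qed
    qed
    finally show ?thesis .
  qed
  let ?J = "(\<integral>\<^sup>+t\<in>{t1..t2}. (\<integral>\<^sup>+x\<in>{1<..}. ennreal (x powr (p + \<gamma>)) \<partial>w t) \<partial>lborel)"
  have "?J = (\<integral>\<^sup>+s. (SUP n. F n s * indicator {t1..t2} s) \<partial>lborel)"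
    by (intro nn_integral_cong) (auto simp: supF indicator_def)
  also have "\<dots> = (SUP n. \<integral>\<^sup>+s\<in>{t1..t2}. F n s \<partial>lborel)"
    by (rule nn_integral_monotone_convergence_SUP[OF incF]) simp
  finally have "ennreal (m * \<omega>) * ?J = (SUP n. ennreal (m * \<omega>) * (\<integral>\<^sup>+s\<in>{t1..t2}. F n s \<partial>lborel))"
    by (simp add: SUP_mult_left_ennreal)
  also have "\<dots> \<le> ennreal (D * C) * I"
    by (intro SUP_least bound)
  also have "\<dots> < \<infinity>" using fin by (simp add: I_def ennreal_mult_less_top)
  finally show ?thesis using m \<omega> by (auto simp: ennreal_mult_less_top)
qed

text \<open>Each gain of \<gamma> consumes a margin in time, so the induction must range over all
  intervals. The bound on \<open>[a, b]\<close> is drawn from \<open>[a/2, (b + T)/2]\<close>, still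
  a compact part of \<open>(0, T)\<close>. The base case is continuity of the moment of order
  \<open>q\<close>.\<close>

lemma time_integrated_moments_finite:
  assumes "\<theta> > 1" "0 < a" "b < T"
  shows "(\<integral>\<^sup>+t\<in>{a..b}. (\<integral>\<^sup>+x\<in>{1<..}. ennreal (x powr (q + real n * \<gamma>)) \<partial>w t) \<partial>lborel) < \<infinity>"
  using assms(2,3)
proof (induction n arbitrary: a b)
  case 0
  have "bounded ((\<lambda>t. LINT x|w t. x powr q) ` {a..b})"
    using 0 by (intro compact_imp_bounded compact_continuous_image
        continuous_on_subset[OF continuous_moment_w]) auto
  then obtain B where B: "\<And>t. t \<in> {a..b} \<Longrightarrow> (LINT x|w t. x powr q) \<le> B"
    by (force simp: bounded_iff)
  have "(\<integral>\<^sup>+t\<in>{a..b}. (\<integral>\<^sup>+x\<in>{1<..}. ennreal (x powr (q + real 0 * \<gamma>)) \<partial>w t) \<partial>lborel)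
      \<le> (\<integral>\<^sup>+t. ennreal B * indicator {a..b} t \<partial>lborel)"
  proof (rule nn_integral_mono)
    fix t
    show "(\<integral>\<^sup>+x\<in>{1<..}. ennreal (x powr (q + real 0 * \<gamma>)) \<partial>w t) * indicator {a..b} t
        \<le> ennreal B * indicator {a..b} t"
    proof (cases "t \<in> {a..b}")
      case True
      then have t: "t \<in> {0<..<T}" using 0 by auto
      have "(\<integral>\<^sup>+x\<in>{1<..}. ennreal (x powr (q + real 0 * \<gamma>)) \<partial>w t) \<le> (\<integral>\<^sup>+x. ennreal (x powr q) \<partial>w t)"
        by (intro nn_integral_mono) (auto simp: indicator_def)
      also have "\<dots> = ennreal (LINT x|w t. x powr q)"
        by (rule nn_integral_eq_integral[OF integrable_powr_w[OF t]]) simp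
      also have "\<dots> \<le> ennreal B" by (rule ennreal_leI[OF B[OF True]])
      finally show ?thesis using True by simp
    qed simp
  qed
  also have "\<dots> < \<infinity>"
    by (subst nn_integral_cmult_indicator) (auto simp: ennreal_mult_less_top emeasure_lborel_Icc_eq)
  finally show ?case .
next
  case (Suc n)
  show ?case
  proof (cases "a \<le> b")
    case True
    have "(\<integral>\<^sup>+t\<in>{a..b}. (\<integral>\<^sup>+x\<in>{1<..}. ennreal (x powr ((q + real n * \<gamma>) + \<gamma>)) \<partial>w t) \<partial>lborel) < \<infinity>"
    proof (rule moment_gain[of "a / 2" a b "(b + T) / 2"])
      show "(\<integral>\<^sup>+t\<in>{a / 2..(b + T) / 2}. (\<integral>\<^sup>+x\<in>{1<..}. ennreal (x powr (q + real n * \<gamma>)) \<partial>w t) \<partial>lborel) < \<infinity>"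
        using Suc.prems by (intro Suc.IH) auto
    qed (use Suc.prems True assms(1) in auto)
    then show ?thesis by (simp add: algebra_simps)
  qed simp
qed

end

section \<open>Moments of the explicit solution\<close>

text \<open>With \<open>s = 1 - \<gamma> * t\<close>, the atom of mass
  \<open>s powr (1 / \<gamma>)\<close> sits at \<open>s powr (- 1 / \<gamma>) > 1\<close> and alone
  contributes the stated amount; the density part can only add to it.\<close>

lemma explicit_solution_moment_ge:
  fixes \<gamma> \<theta> t p :: real
  assumes "0 < \<gamma>" "0 < t" "\<gamma> * t < 1"
  shows "(\<integral>\<^sup>+x\<in>{1<..}. ennreal (x powr p) \<partial>explicit_solution \<gamma> \<theta> t) \<ge> ennreal ((1 - \<gamma> * t) powr ((1 - p) / \<gamma>))"
proof -
  define s where "s = 1 - \<gamma> * t"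
  have s: "0 < s" "s < 1" using assms by (simp_all add: s_def)
  define y where "y = s powr (- 1 / \<gamma>)"
  have y: "y > 0" using s by (simp add: y_def)
  have y1: "y > 1"
    using powr_less_mono2_neg[of "- 1 / \<gamma>" s 1] s assms(1) by (simp add: y_def)
  have ys: "{y} \<in> sets halfline" using y by (subst sets_restrict_space_iff) auto
  have "ennreal (s powr (1 / \<gamma>)) \<le> emeasure (explicit_solution \<gamma> \<theta> t) {y}"
    unfolding explicit_solution_def s_def[symmetric] y_def[symmetric]
    using ys by (subst emeasure_add_measure) auto
  then have "ennreal (y powr p) * ennreal (s powr (1 / \<gamma>)) \<le> ennreal (y powr p) * emeasure (explicit_solution \<gamma> \<theta> t) {y}"
    by (rule mult_left_mono) simp
  also have "\<dots> = (\<integral>\<^sup>+x. ennreal (y powr p) * indicator {y} x \<partial>explicit_solution \<gamma> \<theta> t)"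
    using ys by (intro nn_integral_cmult_indicator[symmetric]) (simp add: explicit_solution_def)
  also have "\<dots> \<le> (\<integral>\<^sup>+x\<in>{1<..}. ennreal (x powr p) \<partial>explicit_solution \<gamma> \<theta> t)"
    using y1 by (intro nn_integral_mono) (auto simp: indicator_def)
  also have "ennreal (y powr p) * ennreal (s powr (1 / \<gamma>)) = ennreal (s powr ((1 - p) / \<gamma>))"
    unfolding y_def by (simp add: ennreal_mult'[symmetric] powr_powr powr_add[symmetric] diff_divide_distrib)
  finally show ?thesis by (simp add: s_def)
qed

text \<open>The threshold on \<open>p\<close> makes the exponent of \<open>1 - \<gamma> * t\<close>
  at most -2. A rectangle of width \<epsilon> ending at \<open>1 / \<gamma>\<close> then already has
  area \<open>1 / (\<gamma>\<^sup>2 * \<epsilon>)\<close>, which is unbounded as \<epsilon> shrinks;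
  with exponent -1 such rectangles would have bounded area.\<close>

lemma explicit_solution_moment_not_integrable:
  fixes \<gamma> \<theta> p :: real
  assumes \<gamma>: "0 < \<gamma>" and p: "p \<ge> 1 + 2 * \<gamma>" and w: "\<And>t. t \<in> {0<..<1/\<gamma>} \<Longrightarrow> w t = explicit_solution \<gamma> \<theta> t"
  shows "(\<integral>\<^sup>+t\<in>{1 / (2 * \<gamma>)..1 / \<gamma>}. (\<integral>\<^sup>+x\<in>{1<..}. ennreal (x powr p) \<partial>w t) \<partial>lborel) = \<infinity>"
    (is "?J = _")
proof (rule ccontr)
  assume "?J \<noteq> \<infinity>"
  then obtain r where r: "?J = ennreal r" "r \<ge> 0" by (cases ?J) auto
  \<comment> \<open>The first entry keeps the rectangle inside the interval of integration, the
    second makes its area at least \<open>r + 1\<close>.\<close>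
  define \<epsilon> where "\<epsilon> = min (1 / (2 * \<gamma>)) (1 / (\<gamma>\<^sup>2 * (r + 1)))"
  have \<epsilon>: "\<epsilon> > 0" "\<epsilon> \<le> 1 / (2 * \<gamma>)" "\<epsilon> \<le> 1 / (\<gamma>\<^sup>2 * (r + 1))"
    using \<gamma> r(2) by (auto simp: \<epsilon>_def)
  have "ennreal ((\<gamma> * \<epsilon>) powr - 2) * ennreal \<epsilon>
      = (\<integral>\<^sup>+t. ennreal ((\<gamma> * \<epsilon>) powr - 2) * indicator {1 / \<gamma> - \<epsilon>..<1 / \<gamma>} t \<partial>lborel)"
    using \<epsilon>(1) by (subst nn_integral_cmult_indicator) auto
  \<comment> \<open>The rectangle omits its right endpoint, since \<open>w\<close> is identified
    with the explicit solution strictly before \<open>1 / \<gamma>\<close>.\<close>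
  also have "\<dots> \<le> ?J"
  proof (rule nn_integral_mono)
    fix t
    show "ennreal ((\<gamma> * \<epsilon>) powr - 2) * indicator {1 / \<gamma> - \<epsilon>..<1 / \<gamma>} t
        \<le> (\<integral>\<^sup>+x\<in>{1<..}. ennreal (x powr p) \<partial>w t) * indicator {1 / (2 * \<gamma>)..1 / \<gamma>} t"
    proof (cases "t \<in> {1 / \<gamma> - \<epsilon>..<1 / \<gamma>}")
      case True
      have "1 / \<gamma> - 1 / (2 * \<gamma>) = 1 / (2 * \<gamma>)" using \<gamma> by (simp add: field_simps)
      then have t: "1 / (2 * \<gamma>) \<le> t" "t < 1 / \<gamma>" using True \<epsilon>(2) by auto
      then have t0: "0 < t" using \<gamma> by (smt (verit) divide_pos_pos)
      have s: "0 < 1 - \<gamma> * t" "1 - \<gamma> * t \<le> \<gamma> * \<epsilon>" "1 - \<gamma> * t < 1"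
        using True \<gamma> t0 by (auto simp: field_simps)
      have e: "(1 - p) / \<gamma> \<le> - 2" using p \<gamma> by (simp add: field_simps)
      have "(\<gamma> * \<epsilon>) powr - 2 \<le> (1 - \<gamma> * t) powr - 2"
        using s by (intro powr_mono2') auto
      also have "\<dots> \<le> (1 - \<gamma> * t) powr ((1 - p) / \<gamma>)"
        using s e by (intro powr_mono') auto
      finally have "ennreal ((\<gamma> * \<epsilon>) powr - 2) \<le> ennreal ((1 - \<gamma> * t) powr ((1 - p) / \<gamma>))"
        by (rule ennreal_leI)
      also have "\<dots> \<le> (\<integral>\<^sup>+x\<in>{1<..}. ennreal (x powr p) \<partial>w t)"
        using explicit_solution_moment_ge[of \<gamma> t p \<theta>] \<gamma> s t t0 w[of t] by simp
      finally show ?thesis using True t by simp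
    qed simp
  qed
  finally have "(\<gamma> * \<epsilon>) powr - 2 * \<epsilon> \<le> r"
    using r \<epsilon>(1) by (simp add: ennreal_mult'[symmetric] ennreal_le_iff)
  moreover have "(\<gamma> * \<epsilon>) powr - 2 * \<epsilon> = 1 / (\<gamma>\<^sup>2 * \<epsilon>)"
    using \<gamma> \<epsilon>(1) by (simp add: powr_minus field_simps power2_eq_square)
  moreover have "r + 1 \<le> 1 / (\<gamma>\<^sup>2 * \<epsilon>)"
  proof -
    have "\<gamma>\<^sup>2 * (r + 1) > 0" using \<gamma> r(2) by simp
    then have "\<epsilon> * (\<gamma>\<^sup>2 * (r + 1)) \<le> 1" using \<epsilon>(3) by (simp only: pos_le_divide_eq)
    then show ?thesis using \<epsilon>(1) \<gamma> by (simp add: pos_le_divide_eq mult_ac)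
  qed
  ultimately show False by linarith
qed

section \<open>The contradiction at time \<open>1 / \<gamma>\<close>\<close>

theorem theorem1p3:
  fixes \<gamma> \<theta> T :: real
  assumes "0 < \<gamma>" and "\<gamma> < 2" and "\<theta> > 1" and "T > 1 / \<gamma>"
  shows "\<not> (\<exists>w :: real \<Rightarrow> real measure.
      curve_functional 0 T w \<in> distributions1 (strip 0 T) \<and>
      weak_solution \<gamma> \<theta> 0 T w \<and>
      (\<forall>t\<in>{0<..<1/\<gamma>}. w t = explicit_solution \<gamma> \<theta> t) \<and>
      (\<exists>\<rho>\<in>{0<..<2 - \<gamma>}.
         (\<exists>\<delta>>0. continuous_in_moment_space (\<rho> - 1 - \<delta>) {0..<T} w \<and>
                 continuous_in_moment_space (\<rho> + \<gamma> - 1 + \<delta>) {0..<T} w) \<and>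
         weak_star_tendsto \<rho> (\<rho> + \<gamma>) (\<lambda>t. measure_functional (w t))
           (measure_functional (return halfline 1)) (at_right 0)))"
proof
  assume "\<exists>w :: real \<Rightarrow> real measure.
      curve_functional 0 T w \<in> distributions1 (strip 0 T) \<and>
      weak_solution \<gamma> \<theta> 0 T w \<and>
      (\<forall>t\<in>{0<..<1/\<gamma>}. w t = explicit_solution \<gamma> \<theta> t) \<and>
      (\<exists>\<rho>\<in>{0<..<2 - \<gamma>}.
         (\<exists>\<delta>>0. continuous_in_moment_space (\<rho> - 1 - \<delta>) {0..<T} w \<and>
                 continuous_in_moment_space (\<rho> + \<gamma> - 1 + \<delta>) {0..<T} w) \<and>
         weak_star_tendsto \<rho> (\<rho> + \<gamma>) (\<lambda>t. measure_functional (w t))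
           (measure_functional (return halfline 1)) (at_right 0))"
  \<comment> \<open>The starting order \<open>q\<close> is taken from the moment continuity in the
    hypothesis.\<close>
  then obtain w q where w: "weak_solution \<gamma> \<theta> 0 T w" "continuous_in_moment_space q {0..<T} w"
    "\<And>t. t \<in> {0<..<1/\<gamma>} \<Longrightarrow> w t = explicit_solution \<gamma> \<theta> t"
    by blast
  interpret moment_solution \<gamma> \<theta> T q w
    using w by unfold_locales
  \<comment> \<open>\<open>n\<close> steps of size \<gamma> lift \<open>q\<close> to the order
    \<open>1 + 2 * \<gamma>\<close> at which the Dirac mass is not integrable in time.\<close>
  obtain n :: nat where "real n > (1 + 2 * \<gamma> - q) / \<gamma>"
    using reals_Archimedean2 by blast
  then have p: "q + real n * \<gamma> \<ge> 1 + 2 * \<gamma>"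
    using assms(1) by (simp add: field_simps)
  \<comment> \<open>Because \<open>T > 1 / \<gamma>\<close>, the interval
    \<open>[1 / (2 * \<gamma>), 1 / \<gamma>]\<close> is a compact part of \<open>(0, T)\<close>:
    the same integral is finite by the bootstrap and infinite by the Dirac mass.\<close>
  show False
    using time_integrated_moments_finite[of "1 / (2 * \<gamma>)" "1 / \<gamma>" n]
      explicit_solution_moment_not_integrable[OF assms(1) p, of w \<theta>] w(3) assms by simp
qed

end
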